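(* Let $I=[0,1]$ and let $F:I\to\mathbb{R}$ be a differentiable Lipschitz function such that for every set $A\subset I$ of full Lebesgue outer measure in $I$, the image $F'(A)$ has Hausdorff dimension $1$. Then for any set $X$ of lines in $\mathbb{R}^2$ with $\operatorname{graph}(F)\subset\bigcup X$, the union $\bigcup X$ has Hausdorff dimension $2$.
   Context: $\operatorname{graph}(F)=\{(x,F(x)) : x\in I\}\subset\mathbb{R}^2$. A set $A\subset I$ (not necessarily measurable) has full Lebesgue outer measure in $I$ if its Lebesgue outer measure equals that of $I$. Differentiability at the endpoints is one-sided. *)

theory Defs
  imports "HOL-Analysis.Analysis"
begin

text \<open>
  The summand \<open>(diam U)\<^sup>s\<close> of the Hausdorff sums, with the usual conventions at \<open>s = 0\<close>:
  the empty set contributes 0 and every nonempty set contributes 1.  The case \<open>s = 0\<close> is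
  separate because \<open>0 powr 0 = 0\<close>.
\<close>

definition hausdorff_weight :: "real \<Rightarrow> 'a::metric_space set \<Rightarrow> ennreal" where
  "hausdorff_weight s U =
     (if U = {} then 0 else if s = 0 then 1 else ennreal (diameter U powr s))"

text \<open>
  Boundedness of the covering sets is required explicitly because \<open>diameter\<close> is real-valued and
  carries no information on unbounded sets.  Finite covers are included, padded by empty sets.
\<close>

definition hausdorff_premeasure :: "real \<Rightarrow> real \<Rightarrow> 'a::metric_space set \<Rightarrow> ennreal" where
  "hausdorff_premeasure s \<delta> A =
     (INF U \<in> {U :: nat \<Rightarrow> 'a set. A \<subseteq> (\<Union>n. U n) \<and> (\<forall>n. bounded (U n) \<and> diameter (U n) \<le> \<delta>)}.
        \<Sum>n. hausdorff_weight s (U n))"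

definition hausdorff_measure :: "real \<Rightarrow> 'a::metric_space set \<Rightarrow> ennreal" where
  "hausdorff_measure s A = (SUP \<delta> \<in> {0<..}. hausdorff_premeasure s \<delta> A)"

definition hausdorff_dim :: "'a::metric_space set \<Rightarrow> ereal" where
  "hausdorff_dim A = (INF s \<in> {s. 0 \<le> s \<and> hausdorff_measure s A = 0}. ereal s)"

definition is_line :: "(real \<times> real) set \<Rightarrow> bool" where
  "is_line l \<longleftrightarrow> affine l \<and> aff_dim l = 1"

end

theory Submission imports Defs begin

text \<open>
  The dimension of a plane set is at most 2, so only the lower bound is at stake.  Call a
  non-vertical line through a point of the graph tangent if its slope is the derivative there,
  and transversal otherwise.  A non-vertical line is recorded by its slope and
  intercept; let \<open>E\<close> be the set of pairs \<open>(a, b)\<close> for which the segment of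
  \<open>y = a x + b\<close> over \<open>[0,1]\<close> lies in \<open>\<Union>X\<close>.  Suppose \<open>\<Union>X\<close> has dimension less than 2.

  The main step (\<open>hausdorff_content_lines_eq_0\<close>) is that \<open>E\<close> then has dimension at most some
  \<open>s < 1\<close>: a set of lines of dimension \<open>s \<le> 1\<close> has a union of dimension at least \<open>1 + s\<close>.
  Interchanging the coordinates, the same step shows that the abscissae of the vertical lines
  contained in \<open>\<Union>X\<close> form a null set.

  Near a foot where the line crosses the graph transversally, the foot is a Lipschitz function
  of \<open>(a, b)\<close>: a second line close to the first meets the graph close to the first foot, because
  the graph leaves the first line at a definite rate.  Since \<open>E\<close> has dimension less than 1, the
  feet of transversal lines form a null set (\<open>transversal_feet_null\<close>).  Therefore for almost
  every \<open>x\<close> the tangent at \<open>x\<close> belongs to \<open>E\<close>.  The set \<open>A\<close> of these \<open>x\<close> has full outer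
  measure, so \<open>F'(A)\<close> has dimension 1; yet \<open>F'(A)\<close> is contained in the projection of \<open>E\<close> to the
  slope axis, whose dimension is at most \<open>s\<close>.  This is a contradiction.

  In the main step the role of a Frostman measure on \<open>E\<close> is played by finite sets.
  Cover \<open>\<Union>X\<close> by dyadic squares with small sum of side lengths to the power \<open>u\<close>,
  where \<open>u < 1 + s\<close>.  Each segment spends total time at least 1 in these squares, so it spends
  at least time \<open>c q\<^sup>k\<close> in the squares of side \<open>2\<^sup>-\<^sup>k\<close> for some \<open>k\<close>; fix \<open>k\<close> and consider
  only these segments.  Among their parameters, choose a finite set \<open>P\<close> of largest cardinality
  subject to each dyadic square of side \<open>2\<^sup>-\<^sup>j\<close>, \<open>j \<le> k\<close>, containing at most
  \<open>2\<^bsup>s(k - j)\<^esup>\<close> points of \<open>P\<close>.  By maximality the cardinality of \<open>P\<close> controls the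
  \<open>s\<close>-dimensional content of all the parameters (\<open>regular_net\<close>).  Conversely, two lines whose
  parameters are at distance \<open>d\<close> can be within \<open>2\<^sup>-\<^sup>k\<close> of each other for a time at most of order
  \<open>2\<^sup>-\<^sup>k / d\<close>, so Cordoba's \<open>L\<^sup>2\<close> argument bounds the cardinality of \<open>P\<close> by the number of
  squares of side \<open>2\<^sup>-\<^sup>k\<close> in the cover (\<open>card_regular_lines_le\<close>).  Summing over \<open>k\<close> gives a
  convergent geometric series.
\<close>

section \<open>Hausdorff content\<close>

text \<open>
  The infimum over all covers, with no bound on the diameters.  The content and the Hausdorff
  measure have the same null sets in positive dimension, and the content is much easier to
  estimate.
\<close>

definition hausdorff_content :: "real \<Rightarrow> 'a::metric_space set \<Rightarrow> ennreal" where
  "hausdorff_content s A =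
     (INF U \<in> {U :: nat \<Rightarrow> 'a set. A \<subseteq> (\<Union>n. U n) \<and> (\<forall>n. bounded (U n))}.
        \<Sum>n. ennreal (diameter (U n) powr s))"

lemma hausdorff_content_le:
  fixes U :: "nat \<Rightarrow> 'a::metric_space set"
  assumes "A \<subseteq> (\<Union>n. U n)" "\<And>n. bounded (U n)"
  shows "hausdorff_content s A \<le> (\<Sum>n. ennreal (diameter (U n) powr s))"
  unfolding hausdorff_content_def using assms by (intro INF_lower) auto

lemma hausdorff_content_lessE:
  fixes A :: "'a::metric_space set"
  assumes "hausdorff_content s A < c"
  obtains U :: "nat \<Rightarrow> 'a set" where "A \<subseteq> (\<Union>n. U n)" "\<And>n. bounded (U n)"
    "(\<Sum>n. ennreal (diameter (U n) powr s)) < c"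
  using assms unfolding hausdorff_content_def INF_less_iff by blast

lemma hausdorff_content_mono:
  assumes "A \<subseteq> B"
  shows "hausdorff_content s A \<le> hausdorff_content s B"
  unfolding hausdorff_content_def using assms by (intro INF_superset_mono) auto

lemma diameter_le_dist:
  fixes S :: "'a::metric_space set"
  assumes "0 \<le> d" "\<And>x y. x \<in> S \<Longrightarrow> y \<in> S \<Longrightarrow> dist x y \<le> d"
  shows "diameter S \<le> d"
  using assms by (auto simp: diameter_def intro!: cSUP_least)

lemma hausdorff_content_finite_cover:
  fixes U :: "'i \<Rightarrow> 'a::metric_space set"
  assumes "finite I" "A \<subseteq> (\<Union>i\<in>I. U i)" "\<And>i. i \<in> I \<Longrightarrow> bounded (U i)"
    and d: "\<And>i. i \<in> I \<Longrightarrow> diameter (U i) \<le> d i" and "0 < s"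
  shows "hausdorff_content s A \<le> ennreal (\<Sum>i\<in>I. d i powr s)"
proof -
  obtain h where h: "bij_betw h {0..<card I} I"
    using ex_bij_betw_nat_finite[OF \<open>finite I\<close>] by blast
  define V where "V n = (if n < card I then U (h n) else {})" for n
  have hI: "h n \<in> I" if "n < card I" for n
    using h that by (auto simp: bij_betw_def)
  have bd: "bounded (V n)" for n
    using assms(3) hI by (auto simp: V_def)
  have "A \<subseteq> (\<Union>n. V n)"
  proof
    fix x assume "x \<in> A"
    then obtain i where i: "i \<in> I" "x \<in> U i" using assms(2) by auto
    then obtain n where "n < card I" "h n = i"
      using h unfolding bij_betw_def by (metis atLeastLessThan_iff imageE)
    with i show "x \<in> (\<Union>n. V n)" by (auto simp: V_def)
  qed
  then have "hausdorff_content s A \<le> (\<Sum>n. ennreal (diameter (V n) powr s))"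
    using bd by (rule hausdorff_content_le)
  also have "\<dots> = (\<Sum>n\<in>{0..<card I}. ennreal (diameter (V n) powr s))"
    using \<open>0 < s\<close> by (intro suminf_finite) (auto simp: V_def)
  also have "\<dots> = (\<Sum>n\<in>{0..<card I}. ennreal (diameter (U (h n)) powr s))"
    by (intro sum.cong) (auto simp: V_def)
  also have "\<dots> = (\<Sum>i\<in>I. ennreal (diameter (U i) powr s))"
    using h by (rule sum.reindex_bij_betw)
  also have "\<dots> \<le> (\<Sum>i\<in>I. ennreal (d i powr s))"
    using d assms(3) \<open>0 < s\<close>
    by (intro sum_mono ennreal_leI powr_mono2) (auto intro: diameter_ge_0)
  also have "\<dots> = ennreal (\<Sum>i\<in>I. d i powr s)"
    by (simp add: sum_ennreal)
  finally show ?thesis .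
qed

lemma hausdorff_content_UN_le:
  fixes A :: "nat \<Rightarrow> 'a::metric_space set"
  shows "hausdorff_content s (\<Union>n. A n) \<le> (\<Sum>n. hausdorff_content s (A n))"
proof (rule ennreal_le_epsilon)
  fix e :: real
  assume fin: "(\<Sum>n. hausdorff_content s (A n)) < top" and "0 < e"
  have *: "\<exists>U :: nat \<Rightarrow> 'a set. A n \<subseteq> (\<Union>i. U i) \<and> (\<forall>i. bounded (U i)) \<and>
      (\<Sum>i. ennreal (diameter (U i) powr s)) < hausdorff_content s (A n) + ennreal (e * (1/2) ^ Suc n)"
    for n
  proof -
    have "hausdorff_content s (A n) < top"
      using fin by (rule ennreal_suminf_lessD)
    then have "hausdorff_content s (A n) < hausdorff_content s (A n) + ennreal (e * (1/2) ^ Suc n)"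
      using \<open>0 < e\<close> by (cases "hausdorff_content s (A n)") (auto simp: ennreal_less_iff simp flip: ennreal_plus)
    then show ?thesis by (rule hausdorff_content_lessE) blast
  qed
  then obtain U :: "nat \<Rightarrow> nat \<Rightarrow> 'a set" where
    U: "\<And>n. A n \<subseteq> (\<Union>i. U n i)" "\<And>n i. bounded (U n i)"
      "\<And>n. (\<Sum>i. ennreal (diameter (U n i) powr s))
         < hausdorff_content s (A n) + ennreal (e * (1/2) ^ Suc n)"
    by metis
  define V where "V m = (case prod_decode m of (n, i) \<Rightarrow> U n i)" for m
  have "(\<Union>n. A n) \<subseteq> (\<Union>m. V m)"
  proof
    fix x assume "x \<in> (\<Union>n. A n)"
    then obtain n i where "x \<in> U n i" using U(1) by blast
    then have "x \<in> V (prod_encode (n, i))" by (simp add: V_def)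
    then show "x \<in> (\<Union>m. V m)" by blast
  qed
  then have "hausdorff_content s (\<Union>n. A n) \<le> (\<Sum>m. ennreal (diameter (V m) powr s))"
    by (rule hausdorff_content_le) (auto simp: V_def U split: prod.split)
  also have "\<dots> = (\<Sum>n. \<Sum>i. ennreal (diameter (U n i) powr s))"
    by (subst suminf_ennreal_2dimen
        [where f = "\<lambda>(n, i). ennreal (diameter (U n i) powr s)", symmetric])
      (auto simp: V_def split: prod.split intro!: suminf_cong)
  also have "\<dots> \<le> (\<Sum>n. hausdorff_content s (A n) + ennreal (e * (1/2) ^ Suc n))"
    using U(3) by (intro suminf_le) (auto intro: less_imp_le)
  also have "\<dots> = (\<Sum>n. hausdorff_content s (A n)) + (\<Sum>n. ennreal (e * (1/2) ^ Suc n))"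
    by (rule suminf_add[symmetric]) auto
  also have "(\<Sum>n. ennreal (e * (1/2) ^ Suc n)) = ennreal e"
    using sums_mult[OF power_half_series, of e] \<open>0 < e\<close>
    by (intro suminf_ennreal_eq) auto
  finally show "hausdorff_content s (\<Union>n. A n) \<le> (\<Sum>n. hausdorff_content s (A n)) + ennreal e" .
qed

lemma hausdorff_content_eq_0_UN:
  assumes "countable I" "\<And>i. i \<in> I \<Longrightarrow> hausdorff_content s (A i) = 0"
  shows "hausdorff_content s (\<Union>i\<in>I. A i) = 0"
proof (cases "I = {}")
  case True
  then show ?thesis
    using hausdorff_content_le[of "{}" "\<lambda>_. {}" s] by simp
next
  case False
  have "(\<Union>i\<in>I. A i) = (\<Union>n. A (from_nat_into I n))"
    using False assms(1) by (metis UN_extend_simps(10) range_from_nat_into)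
  moreover have "hausdorff_content s (A (from_nat_into I n)) = 0" for n
    using False assms(2) from_nat_into by metis
  ultimately show ?thesis
    using hausdorff_content_UN_le[of s "\<lambda>n. A (from_nat_into I n)"] by simp
qed

lemma hausdorff_content_eq_0_subset:
  "hausdorff_content s B = 0 \<Longrightarrow> A \<subseteq> B \<Longrightarrow> hausdorff_content s A = 0"
  using hausdorff_content_mono by (metis le_zero_eq)

lemma hausdorff_content_eq_0I:
  assumes "0 < C" "\<And>e. 0 < e \<Longrightarrow> hausdorff_content s A \<le> ennreal (C * e)"
  shows "hausdorff_content s A = 0"
proof -
  have "hausdorff_content s A \<le> 0 + ennreal e" if "0 < e" for e
    using assms(2)[of "e / C"] assms(1) that by simp
  then have "hausdorff_content s A \<le> 0" by (rule ennreal_le_epsilon)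
  then show ?thesis by simp
qed

text \<open>
  Lipschitz images of null sets are null.  The map from a part of \<open>E\<close> onto \<open>A\<close> is
  given by a relation, since in the application a point of \<open>A\<close> may be the image of several points
  of \<open>E\<close>, none of them distinguished.
\<close>

lemma hausdorff_content_eq_0_relation:
  fixes E :: "'a::metric_space set" and A :: "'b::metric_space set"
  assumes null: "hausdorff_content s E = 0" and "0 < s"
    and ex: "\<And>x. x \<in> A \<Longrightarrow> \<exists>p\<in>E. R x p"
    and lip: "\<And>x y p q. x \<in> A \<Longrightarrow> y \<in> A \<Longrightarrow> R x p \<Longrightarrow> R y q \<Longrightarrow> dist x y \<le> L * dist p q"
    and "0 < L"
  shows "hausdorff_content s A = 0"
proof (rule hausdorff_content_eq_0I)
  show "0 < L powr s" using \<open>0 < L\<close> by simp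
  fix e :: real assume "0 < e"
  then have "hausdorff_content s E < ennreal e" by (simp add: null)
  then obtain U :: "nat \<Rightarrow> 'a set" where U: "E \<subseteq> (\<Union>n. U n)" "\<And>n. bounded (U n)"
    "(\<Sum>n. ennreal (diameter (U n) powr s)) < ennreal e"
    by (rule hausdorff_content_lessE) blast
  define V where "V n = {x \<in> A. \<exists>p\<in>U n. R x p}" for n
  have dV: "dist x y \<le> L * diameter (U n)" if "x \<in> V n" "y \<in> V n" for n x y
  proof -
    from that obtain p q where "x \<in> A" "y \<in> A" "p \<in> U n" "q \<in> U n" "R x p" "R y q"
      by (auto simp: V_def)
    then show ?thesis
      using lip[of x y p q] diameter_bounded_bound[OF U(2), of p n q] \<open>0 < L\<close>
      by (meson mult_left_mono order_trans less_imp_le)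
  qed
  have bV: "bounded (V n)" for n
    unfolding bounded_two_points using dV by blast
  have diam: "diameter (V n) \<le> L * diameter (U n)" for n
    using dV \<open>0 < L\<close> U(2)
    by (intro diameter_le_dist) (auto intro!: mult_nonneg_nonneg diameter_ge_0)
  have "hausdorff_content s A \<le> (\<Sum>n. ennreal (diameter (V n) powr s))"
  proof (rule hausdorff_content_le[OF _ bV])
    show "A \<subseteq> (\<Union>n. V n)"
      using ex U(1) by (fastforce simp: V_def)
  qed
  also have "\<dots> \<le> (\<Sum>n. ennreal (L powr s) * ennreal (diameter (U n) powr s))"
  proof (intro suminf_le)
    fix n
    have "diameter (V n) powr s \<le> (L * diameter (U n)) powr s"
      using diam bV \<open>0 < s\<close> by (intro powr_mono2) (auto intro: diameter_ge_0)
    also have "\<dots> = L powr s * diameter (U n) powr s"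
      using \<open>0 < L\<close> U(2) by (simp add: powr_mult diameter_ge_0)
    finally show "ennreal (diameter (V n) powr s)
        \<le> ennreal (L powr s) * ennreal (diameter (U n) powr s)"
      by (simp add: ennreal_mult[symmetric])
  qed auto
  also have "\<dots> = ennreal (L powr s) * (\<Sum>n. ennreal (diameter (U n) powr s))"
    by simp
  also have "\<dots> \<le> ennreal (L powr s) * ennreal e"
    using U(3) by (intro mult_left_mono) auto
  also have "\<dots> = ennreal (L powr s * e)"
    using \<open>0 < e\<close> by (simp add: ennreal_mult)
  finally show "hausdorff_content s A \<le> ennreal (L powr s * e)" .
qed

text \<open>
  In a cover with a small sum, every single set is small.  This is why the restriction on
  diameters in the Hausdorff premeasure does not matter for null sets.
\<close>

lemma diameter_less_of_suminf:
  fixes U :: "nat \<Rightarrow> 'a::metric_space set"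
  assumes "0 < s" "0 < d" "bounded (U n)"
    "(\<Sum>n. ennreal (diameter (U n) powr s)) < ennreal (d powr s)"
  shows "diameter (U n) < d"
proof -
  have "ennreal (diameter (U n) powr s) < ennreal (d powr s)"
    using assms(4) by (rule ennreal_suminf_lessD)
  then have "diameter (U n) powr s < d powr s"
    by (simp add: ennreal_less_iff)
  then show ?thesis
    using assms by (meson diameter_ge_0 less_imp_le not_le powr_mono2)
qed

lemma hausdorff_content_eq_0_exponent:
  fixes A :: "'a::metric_space set"
  assumes "hausdorff_content s A = 0" "0 < s" "s \<le> t"
  shows "hausdorff_content t A = 0"
proof (rule hausdorff_content_eq_0I[where C = 1])
  fix e :: real assume "0 < e"
  then have "hausdorff_content s A < ennreal (min e 1)" by (simp add: assms(1))
  then obtain U :: "nat \<Rightarrow> 'a set" where U: "A \<subseteq> (\<Union>n. U n)" "\<And>n. bounded (U n)"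
    "(\<Sum>n. ennreal (diameter (U n) powr s)) < ennreal (min e 1)"
    by (rule hausdorff_content_lessE) blast
  have "(\<Sum>n. ennreal (diameter (U n) powr s)) < ennreal (1 powr s)"
    using U(3) by (rule less_le_trans) (simp add: ennreal_leI)
  then have d1: "diameter (U n) < 1" for n
    using assms(2) U(2) by (intro diameter_less_of_suminf[of s 1]) auto
  have "hausdorff_content t A \<le> (\<Sum>n. ennreal (diameter (U n) powr t))"
    using U by (intro hausdorff_content_le)
  also have "\<dots> \<le> (\<Sum>n. ennreal (diameter (U n) powr s))"
    using d1 assms U(2) by (intro suminf_le ennreal_leI powr_mono') (auto intro: diameter_ge_0 less_imp_le)
  also have "\<dots> \<le> ennreal (min e 1)" using U(3) by simp
  also have "\<dots> \<le> ennreal (1 * e)" by (intro ennreal_leI) auto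
  finally show "hausdorff_content t A \<le> ennreal (1 * e)" .
qed simp

lemma hausdorff_weight_pos:
  "0 < s \<Longrightarrow> hausdorff_weight s U = ennreal (diameter U powr s)"
  by (simp add: hausdorff_weight_def)

lemma hausdorff_measure_eq_0_iff:
  fixes A :: "'a::metric_space set"
  assumes "0 < s"
  shows "hausdorff_measure s A = 0 \<longleftrightarrow> hausdorff_content s A = 0"
proof
  assume "hausdorff_measure s A = 0"
  then have "hausdorff_premeasure s 1 A = 0"
    unfolding hausdorff_measure_def
    by (metis SUP_upper greaterThan_iff le_zero_eq zero_less_one)
  moreover have "hausdorff_content s A \<le> hausdorff_premeasure s 1 A"
    unfolding hausdorff_content_def hausdorff_premeasure_def hausdorff_weight_pos[OF assms]
    by (intro INF_superset_mono) auto
  ultimately show "hausdorff_content s A = 0" by simp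
next
  assume null: "hausdorff_content s A = 0"
  have le: "hausdorff_premeasure s d A \<le> 0 + ennreal e" if "0 < d" "0 < e" for d e
  proof -
    have "hausdorff_content s A < ennreal (min e (d powr s))"
      using that by (simp add: null)
    then obtain U :: "nat \<Rightarrow> 'a set" where U: "A \<subseteq> (\<Union>n. U n)" "\<And>n. bounded (U n)"
      "(\<Sum>n. ennreal (diameter (U n) powr s)) < ennreal (min e (d powr s))"
      by (rule hausdorff_content_lessE) blast
    have "(\<Sum>n. ennreal (diameter (U n) powr s)) < ennreal (d powr s)"
      using U(3) by (rule less_le_trans) (simp add: ennreal_leI)
    then have "diameter (U n) < d" for n
      using assms U(2) that by (intro diameter_less_of_suminf[of s d])
    then have "hausdorff_premeasure s d A \<le> (\<Sum>n. hausdorff_weight s (U n))"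
      unfolding hausdorff_premeasure_def using U by (intro INF_lower) (auto intro: less_imp_le)
    also have "\<dots> \<le> ennreal (min e (d powr s))"
      using U(3) by (simp add: hausdorff_weight_pos[OF assms])
    also have "\<dots> \<le> ennreal e" by (intro ennreal_leI) auto
    finally show ?thesis by simp
  qed
  have "hausdorff_premeasure s d A \<le> 0" if "0 < d" for d
    using le[OF that] by (rule ennreal_le_epsilon)
  then have "hausdorff_measure s A \<le> 0"
    unfolding hausdorff_measure_def by (intro SUP_least) (simp only: greaterThan_iff)
  then show "hausdorff_measure s A = 0" by simp
qed

text \<open>
  A bounded set of reals lies in an interval of twice its diameter, so Hausdorff covers in
  dimension 1 are, up to the factor 2, covers by intervals of small total length.
\<close>

lemma negligible_if_hausdorff_content_1:
  fixes A :: "real set"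
  assumes "hausdorff_content 1 A = 0"
  shows "negligible A"
  unfolding negligible_outer
proof (intro allI impI)
  fix e :: real assume "0 < e"
  then have "hausdorff_content 1 A < ennreal (e / 3)" by (simp add: assms)
  then obtain U :: "nat \<Rightarrow> real set" where U: "A \<subseteq> (\<Union>n. U n)" "\<And>n. bounded (U n)"
    "(\<Sum>n. ennreal (diameter (U n) powr 1)) < ennreal (e / 3)"
    by (rule hausdorff_content_lessE) blast
  have "\<exists>c. U n \<subseteq> cball c (diameter (U n))" for n
    using diameter_bounded_bound[OF U(2)] by (cases "U n = {}") fastforce+
  then obtain c where c: "\<And>n. U n \<subseteq> cball (c n) (diameter (U n))" by metis
  let ?T = "\<Union>n. cball (c n) (diameter (U n))"
  have "emeasure lebesgue ?T \<le> (\<Sum>n. emeasure lebesgue (cball (c n) (diameter (U n))))"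
    by (intro emeasure_subadditive_countably) auto
  also have "\<dots> = (\<Sum>n. 2 * ennreal (diameter (U n) powr 1))"
  proof (intro suminf_cong)
    fix n
    have "0 \<le> diameter (U n)" using U(2) by (rule diameter_ge_0)
    then show "emeasure lebesgue (cball (c n) (diameter (U n))) = 2 * ennreal (diameter (U n) powr 1)"
      by (simp add: cball_eq_atLeastAtMost ennreal_mult[symmetric]
          flip: ennreal_numeral)
  qed
  also have "\<dots> = 2 * (\<Sum>n. ennreal (diameter (U n) powr 1))" by simp
  also have "\<dots> \<le> 2 * ennreal (e / 3)"
    using U(3) by (intro mult_left_mono) auto
  also have "\<dots> = ennreal (2 * (e / 3))"
    by (subst ennreal_mult) (use \<open>0 < e\<close> in auto)
  finally have le: "emeasure lebesgue ?T \<le> ennreal (2 * (e / 3))" .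
  have "?T \<in> lmeasurable"
    using le by (intro fmeasurableI) (auto simp: order_le_less_trans)
  moreover have "measure lebesgue ?T \<le> 2 * (e / 3)"
    using le \<open>0 < e\<close> unfolding measure_def by (intro enn2real_leI) auto
  moreover have "A \<subseteq> ?T" using U(1) c by blast
  ultimately show "\<exists>T. A \<subseteq> T \<and> T \<in> lmeasurable \<and> measure lebesgue T < e"
    using \<open>0 < e\<close> by (intro exI[of _ ?T]) auto
qed

section \<open>Dyadic squares\<close>

text \<open>
  The index of the half-open dyadic square of side \<open>2\<^sup>-\<^sup>k\<close> that contains \<open>p\<close>.  Squares are
  represented by the fibres of this function.
\<close>

definition dyadic_cell :: "nat \<Rightarrow> real \<times> real \<Rightarrow> int \<times> int" where
  "dyadic_cell k p = (\<lfloor>2 ^ k * fst p\<rfloor>, \<lfloor>2 ^ k * snd p\<rfloor>)"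

lemma dyadic_cell_nested:
  assumes "j \<le> k" "dyadic_cell k p = dyadic_cell k q"
  shows "dyadic_cell j p = dyadic_cell j q"
proof -
  have *: "\<lfloor>2 ^ j * x\<rfloor> = \<lfloor>2 ^ k * x\<rfloor> div 2 ^ (k - j)" for x :: real
  proof -
    have "2 ^ j * x = (2 ^ k * x) / real_of_int (2 ^ (k - j))"
      using \<open>j \<le> k\<close> by (simp add: field_simps flip: power_add)
    then show ?thesis by (simp only: floor_divide_real_eq_div zero_le_power zero_le_numeral)
  qed
  show ?thesis
    using assms(2) by (simp add: dyadic_cell_def *)
qed

lemma same_dyadic_cell_abs_diff_less:
  assumes "dyadic_cell k p = dyadic_cell k q"
  shows "\<bar>fst p - fst q\<bar> < 1 / 2 ^ k" "\<bar>snd p - snd q\<bar> < 1 / 2 ^ k"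
proof -
  have *: "\<bar>x - y\<bar> < 1 / 2 ^ k" if "\<lfloor>2 ^ k * x\<rfloor> = \<lfloor>2 ^ k * y\<rfloor>" for x y :: real
  proof -
    have "\<bar>2 ^ k * x - 2 ^ k * y\<bar> < 1" using that by linarith
    then have "2 ^ k * \<bar>x - y\<bar> < 1"
      by (simp add: abs_mult flip: right_diff_distrib)
    then show ?thesis by (simp add: field_simps)
  qed
  show "\<bar>fst p - fst q\<bar> < 1 / 2 ^ k" "\<bar>snd p - snd q\<bar> < 1 / 2 ^ k"
    using assms by (auto simp: dyadic_cell_def intro!: *)
qed

lemma dist_le_abs_diffs: "dist p q \<le> \<bar>fst p - fst q\<bar> + \<bar>snd p - snd q\<bar>" for p q :: "real \<times> real"
  using sqrt_sum_squares_le_sum_abs[of "fst p - fst q" "snd p - snd q"]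
  by (simp add: dist_prod_def dist_real_def)

lemma abs_diff_le_dist:
  fixes p q :: "real \<times> real"
  shows "\<bar>fst p - fst q\<bar> \<le> dist p q" "\<bar>snd p - snd q\<bar> \<le> dist p q"
  using dist_fst_le[of p q] dist_snd_le[of p q] by (auto simp: dist_real_def)

lemma dist_le_if_same_dyadic_cell:
  "dyadic_cell k p = dyadic_cell k q \<Longrightarrow> dist p q \<le> 2 / 2 ^ k"
  using same_dyadic_cell_abs_diff_less[of k p q] dist_le_abs_diffs[of p q] by linarith

lemma bounded_dyadic_cell: "bounded {p. dyadic_cell k p = z}"
  unfolding bounded_two_points by (metis dist_le_if_same_dyadic_cell mem_Collect_eq)

lemma diameter_dyadic_cell: "diameter {p. dyadic_cell k p = z} \<le> 2 / 2 ^ k"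
  by (rule diameter_le_dist) (auto intro: dist_le_if_same_dyadic_cell)

lemma hausdorff_content_le_dyadic:
  assumes "finite Z" "\<And>p. p \<in> A \<Longrightarrow> \<exists>(j, z)\<in>Z. dyadic_cell j p = z" "0 < s"
  shows "hausdorff_content s A \<le> ennreal (\<Sum>(j, z)\<in>Z. (2 / 2 ^ j) powr s)"
proof -
  have "A \<subseteq> (\<Union>w\<in>Z. {p. dyadic_cell (fst w) p = snd w})"
    using assms(2) by (auto simp: split_beta)
  then have "hausdorff_content s A \<le> ennreal (\<Sum>w\<in>Z. (2 / 2 ^ fst w) powr s)"
    using assms(1,3) bounded_dyadic_cell diameter_dyadic_cell
    by (intro hausdorff_content_finite_cover)
  then show ?thesis by (simp add: split_beta)
qed

text \<open>
  The block of 3 by 3 squares around a square: it contains every point of the plane whose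
  coordinates differ from those of a point of the central square by at most one side length.
\<close>

definition neighbour_cells :: "int \<times> int \<Rightarrow> (int \<times> int) set" where
  "neighbour_cells z = {fst z - 1..fst z + 1} \<times> {snd z - 1..snd z + 1}"

lemma neighbour_cells_finite: "finite (neighbour_cells z)" and
  card_neighbour_cells: "card (neighbour_cells z) = 9"
  by (auto simp: neighbour_cells_def)

lemma dyadic_cell_in_neighbour_cells:
  assumes "\<bar>fst p - fst q\<bar> \<le> 1 / 2 ^ k" "\<bar>snd p - snd q\<bar> \<le> 1 / 2 ^ k"
  shows "dyadic_cell k p \<in> neighbour_cells (dyadic_cell k q)"
proof -
  have *: "\<lfloor>2 ^ k * x\<rfloor> \<in> {\<lfloor>2 ^ k * y\<rfloor> - 1..\<lfloor>2 ^ k * y\<rfloor> + 1}" if "\<bar>x - y\<bar> \<le> 1 / 2 ^ k" for x y :: real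
  proof -
    have "2 ^ k * \<bar>x - y\<bar> \<le> 1"
      using that by (simp add: field_simps)
    then have "\<bar>2 ^ k * x - 2 ^ k * y\<bar> \<le> 1"
      by (simp add: abs_mult flip: right_diff_distrib)
    then show ?thesis by simp linarith
  qed
  show ?thesis
    using *[OF assms(1)] *[OF assms(2)] by (simp add: neighbour_cells_def dyadic_cell_def)
qed

text \<open>
  A unit square consists of \<open>4\<^sup>k\<close> squares of side \<open>2\<^sup>-\<^sup>k\<close>, and \<open>4\<^sup>k (2 * 2\<^sup>-\<^sup>k)\<^sup>s\<close> tends to
  0 for \<open>s > 2\<close>.
\<close>

lemma hausdorff_content_plane_eq_0:
  assumes "2 < s"
  shows "hausdorff_content s (UNIV :: (real \<times> real) set) = 0"
proof -
  have cell: "hausdorff_content s {p. dyadic_cell 0 p = z} = 0" for z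
  proof (rule hausdorff_content_eq_0I[where C = "2 powr s"])
    fix e :: real assume "0 < e"
    define \<rho> where "\<rho> = 4 / 2 powr s"
    have "2 powr 2 < 2 powr s" using assms by (intro powr_less_mono) auto
    then have "0 < \<rho>" "\<rho> < 1" by (auto simp: \<rho>_def)
    then obtain k where k: "\<rho> ^ k < e"
      using \<open>0 < e\<close> real_arch_pow_inv by blast
    define Z where "Z = {k} \<times> ({2 ^ k * fst z..<2 ^ k * (fst z + 1)} \<times> {2 ^ k * snd z..<2 ^ k * (snd z + 1)})"
    have card: "real (card Z) = 4 ^ k"
    proof -
      have "card {2 ^ k * a..<2 ^ k * (a + 1)} = 2 ^ k" for a :: int
        by (simp add: algebra_simps nat_power_eq)
      then have "card Z = 2 ^ k * 2 ^ k"
        by (simp only: Z_def card_cartesian_product) simp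
      then have "card Z = 4 ^ k"
        by (simp add: power_mult_distrib[symmetric])
      then show ?thesis by simp
    qed
    have floor: "\<lfloor>2 ^ k * x\<rfloor> \<in> {2 ^ k * a..<2 ^ k * (a + 1)}" if "\<lfloor>x\<rfloor> = a" for x :: real and a
    proof -
      have "of_int a \<le> x" "x < of_int a + 1" using that by linarith+
      then have "2 ^ k * of_int a \<le> 2 ^ k * x" "2 ^ k * x < 2 ^ k * (of_int a + 1)"
        by (auto intro: mult_left_mono mult_strict_left_mono)
      then have "of_int (2 ^ k * a) \<le> 2 ^ k * x" "2 ^ k * x < of_int (2 ^ k * (a + 1))"
        by auto
      then show ?thesis by (simp add: le_floor_iff floor_less_iff)
    qed
    have "hausdorff_content s {p. dyadic_cell 0 p = z} \<le> ennreal (\<Sum>(j, w)\<in>Z. (2 / 2 ^ j) powr s)"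
    proof (rule hausdorff_content_le_dyadic)
      show "finite Z" by (simp add: Z_def)
      show "\<exists>(j, w)\<in>Z. dyadic_cell j p = w" if "p \<in> {p. dyadic_cell 0 p = z}" for p
      proof -
        have "(k, dyadic_cell k p) \<in> Z"
          using that floor[of "fst p"] floor[of "snd p"] by (auto simp: dyadic_cell_def Z_def)
        then show ?thesis by auto
      qed
    qed (use assms in auto)
    also have "(\<Sum>(j, w)\<in>Z. (2 / 2 ^ j) powr s) = (\<Sum>_\<in>Z. (2 / 2 ^ k) powr s)"
      by (intro sum.cong) (auto simp: Z_def)
    also have "\<dots> = 4 ^ k * (2 / 2 ^ k) powr s"
      by (simp add: card)
    also have "\<dots> = 2 powr s * \<rho> ^ k"
      by (simp add: \<rho>_def powr_divide power_divide powr_power powr_powr mult.commute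
          flip: powr_realpow)
    also have "ennreal \<dots> \<le> ennreal (2 powr s * e)"
      using k by (intro ennreal_leI mult_left_mono) auto
    finally show "hausdorff_content s {p. dyadic_cell 0 p = z} \<le> ennreal (2 powr s * e)" .
  qed auto
  have "hausdorff_content s (\<Union>z. {p. dyadic_cell 0 p = z}) = 0"
    by (rule hausdorff_content_eq_0_UN) (auto simp: cell)
  moreover have "(\<Union>z. {p. dyadic_cell 0 p = z}) = UNIV" by auto
  ultimately show ?thesis by simp
qed

section \<open>Regular finite subsets\<close>

lemma card_fibre_pos: "finite P \<Longrightarrow> e \<in> P \<Longrightarrow> 0 < card {p\<in>P. f p = f e}"
  by (auto simp: card_gt_0_iff)

text \<open>
  A finite substitute for a Frostman measure.  Take \<open>P\<close> of largest cardinality among the finite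
  subsets of \<open>E\<close> that satisfy the counting condition.  No point of \<open>E\<close> can be added, so each point
  lies in a square that is full: one more point would violate its bound.  The maximal full
  squares are disjoint and cover \<open>E\<close>, and the contribution of each to the content is at most a
  constant multiple of \<open>2\<^sup>-\<^sup>s\<^sup>k\<close> times its number of points of \<open>P\<close>.
\<close>

lemma regular_net:
  fixes E :: "(real \<times> real) set" and s t :: real
  assumes E: "\<And>p. p \<in> E \<Longrightarrow> dyadic_cell 0 p = z0" and s: "0 < s" "s \<le> 1"
    and t_def: "t = 2 powr s"
  obtains P where "finite P" "P \<subseteq> E"
    "\<And>j z. j \<le> k \<Longrightarrow> card {p\<in>P. dyadic_cell j p = z} \<le> t ^ (k - j)"
    "hausdorff_content s E \<le> ennreal (4 * card P / t ^ k)"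
proof -
  have t: "1 \<le> t" "t \<le> 2"
    using s powr_mono[of s 1 2] by (auto simp: t_def ge_one_powr_ge_zero)
  define good where "good P \<longleftrightarrow> finite P \<and> P \<subseteq> E \<and>
    (\<forall>j z. j \<le> k \<longrightarrow> card {p\<in>P. dyadic_cell j p = z} \<le> t ^ (k - j))" for P
  \<comment> \<open>The condition on the single square of side 1 bounds the cardinality, so a maximum exists.\<close>
  have bound: "card P \<le> nat \<lfloor>t ^ k\<rfloor>" if "good P" for P
  proof -
    have "{p\<in>P. dyadic_cell 0 p = z0} = P"
      using that E by (auto simp: good_def)
    moreover have "card {p\<in>P. dyadic_cell 0 p = z0} \<le> t ^ (k - 0)"
      using that unfolding good_def by blast
    ultimately have "card P \<le> t ^ k" by simp
    then show ?thesis by (rule le_nat_floor)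
  qed
  have "0 \<le> t ^ i" for i using t by simp
  then have "good {}" unfolding good_def by simp
  then have "\<exists>P. good P \<and> (\<forall>Q. good Q \<longrightarrow> card Q \<le> card P)"
    using bound
    by (intro ex_has_greatest_nat[where b = "Suc (nat \<lfloor>t ^ k\<rfloor>)"]) (auto simp: less_Suc_eq_le)
  then obtain P where P: "good P" and max: "\<And>Q. good Q \<Longrightarrow> card Q \<le> card P"
    by blast
  have finP: "finite P" and PE: "P \<subseteq> E"
    and reg: "\<And>j z. j \<le> k \<Longrightarrow> card {p\<in>P. dyadic_cell j p = z} \<le> t ^ (k - j)"
    using P by (auto simp: good_def)
  define full where "full j z \<longleftrightarrow> j \<le> k \<and> t ^ (k - j) < card {p\<in>P. dyadic_cell j p = z} + 1" for j z
  have ex_full: "\<exists>j. full j (dyadic_cell j e)" if "e \<in> E" for e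
  proof (cases "e \<in> P")
    case True
    then have "card {p\<in>P. dyadic_cell k p = dyadic_cell k e} > 0"
      using finP by (intro card_fibre_pos)
    then have "full k (dyadic_cell k e)" by (simp add: full_def)
    then show ?thesis ..
  next
    case False
    have "\<not> good (insert e P)"
      using max[of "insert e P"] False finP by auto
    then obtain j z where j: "j \<le> k" "\<not> card {p\<in>insert e P. dyadic_cell j p = z} \<le> t ^ (k - j)"
      using finP PE \<open>e \<in> E\<close> by (auto simp: good_def)
    have "dyadic_cell j e = z"
    proof (rule ccontr)
      assume "dyadic_cell j e \<noteq> z"
      then have "{p\<in>insert e P. dyadic_cell j p = z} = {p\<in>P. dyadic_cell j p = z}" by auto
      then show False using j reg by simp
    qed
    then have "{p\<in>insert e P. dyadic_cell j p = z} = insert e {p\<in>P. dyadic_cell j p = z}" by auto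
    then have "card {p\<in>insert e P. dyadic_cell j p = z} = Suc (card {p\<in>P. dyadic_cell j p = z})"
      using False finP by simp
    then have "full j z" using j by (simp add: full_def)
    then show ?thesis using \<open>dyadic_cell j e = z\<close> by blast
  qed
  \<comment> \<open>The maximal full square containing \<open>e\<close> is the one of the smallest level.\<close>
  define J where "J e = (LEAST j. full j (dyadic_cell j e))" for e
  have J_full: "full (J e) (dyadic_cell (J e) e)" if "e \<in> E" for e
    using ex_full[OF that] unfolding J_def by (rule LeastI_ex)
  \<comment> \<open>The squares chosen for two points are nested or disjoint; by minimality nested ones coincide.\<close>
  have J_same: "J p = J e" if "e \<in> E" "p \<in> E" "dyadic_cell (J e) p = dyadic_cell (J e) e" for e p
  proof -
    have "full (J e) (dyadic_cell (J e) p)"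
      using J_full[OF that(1)] that(3) by simp
    then have "J p \<le> J e" unfolding J_def by (rule Least_le)
    then have "dyadic_cell (J p) p = dyadic_cell (J p) e"
      using that(3) dyadic_cell_nested by blast
    then have "full (J p) (dyadic_cell (J p) e)"
      using J_full[OF that(2)] by simp
    then have "J e \<le> J p" unfolding J_def by (rule Least_le)
    then show ?thesis using \<open>J p \<le> J e\<close> by simp
  qed
  have witness: "\<exists>p\<in>P. dyadic_cell (J e) p = dyadic_cell (J e) e" if "e \<in> E" for e
  proof -
    have "1 \<le> t ^ (k - J e)" using t by simp
    then have "0 < card {p\<in>P. dyadic_cell (J e) p = dyadic_cell (J e) e}"
      using J_full[OF that] by (auto simp: full_def)
    then show ?thesis by (auto simp: card_gt_0_iff)
  qed
  define \<phi> where "\<phi> p = (J p, dyadic_cell (J p) p)" for p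
  have "hausdorff_content s E \<le> ennreal (\<Sum>(j, z)\<in>\<phi> ` P. (2 / 2 ^ j) powr s)"
  proof (rule hausdorff_content_le_dyadic)
    show "\<exists>(j, z)\<in>\<phi> ` P. dyadic_cell j e = z" if "e \<in> E" for e
    proof -
      obtain p where p: "p \<in> P" "dyadic_cell (J e) p = dyadic_cell (J e) e"
        using witness[OF \<open>e \<in> E\<close>] by blast
      have "J p = J e" using J_same[of e p] p that PE by blast
      then have "\<phi> p = (J e, dyadic_cell (J e) e)" using p by (simp add: \<phi>_def)
      then show ?thesis using p(1) by (force simp: image_iff)
    qed
  qed (use finP s in auto)
  also have "(\<Sum>(j, z)\<in>\<phi> ` P. (2 / 2 ^ j) powr s)
      \<le> (\<Sum>w\<in>\<phi> ` P. (4 / t ^ k) * card {p\<in>P. \<phi> p = w})"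
  proof (rule sum_mono)
    fix w assume "w \<in> \<phi> ` P"
    then obtain e where "e \<in> P" and w: "w = \<phi> e" by blast
    then have "e \<in> E" using PE by blast
    define j where "j = J e"
    let ?Q = "{p\<in>P. dyadic_cell j p = dyadic_cell j e}"
    have j: "j \<le> k" "t ^ (k - j) < card ?Q + 1"
      using J_full[OF \<open>e \<in> E\<close>] by (auto simp: full_def j_def)
    have "1 \<le> card ?Q"
      using \<open>e \<in> P\<close> finP by (simp only: Suc_le_eq card_fibre_pos One_nat_def)
    then have "t ^ (k - j) \<le> 2 * card ?Q" using j(2) by linarith
    then have "t ^ k \<le> 2 * card ?Q * t ^ j"
      using j(1) t by (simp add: power_diff field_simps)
    have "{p\<in>P. \<phi> p = \<phi> e} = ?Q"
      using J_same[OF \<open>e \<in> E\<close>] PE by (auto simp: \<phi>_def j_def)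
    moreover have "(2 / 2 ^ j) powr s \<le> 4 / t ^ k * card ?Q"
    proof -
      have "(2 / 2 ^ j) powr s = t / t ^ j"
        by (simp add: t_def powr_divide powr_power powr_powr mult.commute flip: powr_realpow)
      also have "\<dots> \<le> 2 / t ^ j"
        using t by (intro divide_right_mono) auto
      also have "\<dots> \<le> 4 / t ^ k * card ?Q"
        using \<open>t ^ k \<le> 2 * card ?Q * t ^ j\<close> t by (simp add: field_simps)
      finally show ?thesis .
    qed
    ultimately show "(case w of (j, z) \<Rightarrow> (2 / 2 ^ j) powr s)
        \<le> 4 / t ^ k * card {p\<in>P. \<phi> p = w}"
      by (simp add: \<phi>_def j_def w)
  qed
  also have "\<dots> = 4 / t ^ k * (\<Sum>w\<in>\<phi> ` P. \<Sum>p\<in>{p\<in>P. \<phi> p = w}. 1)"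
    by (simp add: sum_distrib_left)
  also have "(\<Sum>w\<in>\<phi> ` P. \<Sum>p\<in>{p\<in>P. \<phi> p = w}. (1::real)) = card P"
    using sum.image_gen[OF finP, of "\<lambda>_. 1::real" \<phi>] by simp
  finally have "hausdorff_content s E \<le> ennreal (4 * card P / t ^ k)"
    by (simp add: ennreal_leI)
  then show ?thesis using that finP PE reg by blast
qed

section \<open>Dyadic covers of null sets\<close>

text \<open>
  Rounds a diameter up to a power of 2.  The additive error \<open>\<eta>\<close> allows for diameter 0, for which
  any sufficiently large \<open>k\<close> will do.
\<close>

lemma dyadic_scale:
  fixes d u \<eta> :: real
  assumes "0 \<le> d" "d < 1" "0 < u" "0 < \<eta>"
  shows "\<exists>k::nat. d \<le> 1 / 2 ^ k \<and> (1 / 2 ^ k) powr u \<le> (2 * d) powr u + \<eta>"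
proof (cases "d = 0")
  case True
  have "(1/2) powr u < (1::real)" using \<open>0 < u\<close> by (simp add: powr_divide)
  then obtain k where k: "((1/2) powr u) ^ k < \<eta>"
    using \<open>0 < \<eta>\<close> real_arch_pow_inv by blast
  have "(1 / 2 ^ k) powr u = ((1/2) powr u) ^ k"
    by (simp add: powr_power powr_powr powr_divide power_divide mult.commute flip: powr_realpow)
  then show ?thesis using k True \<open>0 < u\<close> by (intro exI[of _ k]) auto
next
  case False
  then have "0 < d" using assms by simp
  then have ex: "\<exists>m. 1 / 2 ^ m < d"
    using real_arch_pow_inv[of d "1/2"] by (auto simp: power_divide)
  define m where "m = (LEAST m. 1 / 2 ^ m < d)"
  have m: "1 / 2 ^ m < d" using ex unfolding m_def by (rule LeastI_ex)
  then have "m \<noteq> 0" using \<open>d < 1\<close> by (intro notI) simp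
  then obtain k where k: "m = Suc k" using not0_implies_Suc by blast
  have "\<not> 1 / 2 ^ k < d" using not_less_Least[of k "\<lambda>m. 1 / 2 ^ m < d"] k unfolding m_def by simp
  moreover have "1 / 2 ^ k < 2 * d" using m by (simp add: k field_simps)
  then have "(1 / 2 ^ k) powr u \<le> (2 * d) powr u" using \<open>0 < u\<close> by (intro powr_mono2) auto
  ultimately show ?thesis using \<open>0 < \<eta>\<close> by (intro exI[of _ k]) auto
qed

text \<open>
  Each set of an efficient cover meets at most nine dyadic squares whose side is its rounded
  diameter.  The smallness of the whole sum bounds the number of squares of each size separately,
  and only this bound is kept.
\<close>

lemma dyadic_cover:
  fixes S :: "(real \<times> real) set"
  assumes null: "hausdorff_content u S = 0" and u: "0 < u" and "0 < \<epsilon>"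
  obtains Y where "\<And>k. finite (Y k)" "\<And>k. card (Y k) \<le> \<epsilon> * (2 powr u) ^ k"
    "\<And>p. p \<in> S \<Longrightarrow> \<exists>k. dyadic_cell k p \<in> Y k"
proof -
  \<comment> \<open>The bound 1 makes all diameters less than 1; the other bound absorbs the factor \<open>2\<^sup>u\<close> of the rounding, the added errors and the nine neighbours.\<close>
  define \<eta> where "\<eta> = min 1 (\<epsilon> / (9 * (2 powr u + 1)))"
  have \<eta>: "0 < \<eta>" "\<eta> \<le> 1"
    using \<open>0 < \<epsilon>\<close> by (auto simp: \<eta>_def add_pos_pos)
  have "\<eta> * (2 powr u + 1) \<le> \<epsilon> / (9 * (2 powr u + 1)) * (2 powr u + 1)"
    by (intro mult_right_mono) (auto simp: \<eta>_def)
  also have "\<dots> = \<epsilon> / 9"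
    by (simp add: field_simps add_pos_pos add_nonneg_eq_0_iff)
  finally have \<eta>\<epsilon>: "(2 powr u + 1) * \<eta> \<le> \<epsilon> / 9" by (simp add: mult.commute)
  have "hausdorff_content u S < ennreal \<eta>" using null \<eta> by simp
  then obtain U :: "nat \<Rightarrow> (real \<times> real) set" where U: "S \<subseteq> (\<Union>n. U n)" "\<And>n. bounded (U n)"
    "(\<Sum>n. ennreal (diameter (U n) powr u)) < ennreal \<eta>"
    by (rule hausdorff_content_lessE) blast
  have "(\<Sum>n. ennreal (diameter (U n) powr u)) < ennreal (1 powr u)"
    using U(3) by (rule less_le_trans) (use \<eta> in \<open>simp add: ennreal_leI\<close>)
  then have d1: "diameter (U n) < 1" for n
    using u U(2) by (intro diameter_less_of_suminf[of u 1]) auto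
  have d0: "0 \<le> diameter (U n)" for n using U(2) by (rule diameter_ge_0)
  define w where "w n = 2 powr u * diameter (U n) powr u + \<eta> * (1/2) ^ Suc n" for n
  have "\<exists>k::nat. diameter (U n) \<le> 1 / 2 ^ k \<and> (1 / 2 ^ k) powr u \<le> w n" for n
    using dyadic_scale[OF d0 d1 u, of "\<eta> * (1/2) ^ Suc n" n] \<eta> d0[of n]
    by (simp add: w_def powr_mult)
  then obtain \<kappa> :: "nat \<Rightarrow> nat" where
    \<kappa>: "\<And>n. diameter (U n) \<le> 1 / 2 ^ \<kappa> n" "\<And>n. (1 / 2 ^ \<kappa> n) powr u \<le> w n"
    by metis
  have w0: "0 \<le> w n" for n using \<eta> by (simp add: w_def)
  have sum_w: "(\<Sum>n\<in>J. w n) \<le> \<epsilon> / 9" if "finite J" for J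
  proof -
    have "ennreal (\<Sum>n\<in>J. w n) = (\<Sum>n\<in>J. ennreal (w n))"
      using w0 by (simp add: sum_ennreal)
    also have "\<dots> \<le> (\<Sum>n. ennreal (w n))"
      using that by (intro sum_le_suminf) auto
    also have "\<dots> = (\<Sum>n. ennreal (2 powr u) * ennreal (diameter (U n) powr u)
        + ennreal (\<eta> * (1/2) ^ Suc n))"
      using \<eta> by (intro suminf_cong) (simp add: w_def ennreal_plus ennreal_mult)
    also have "\<dots> = (\<Sum>n. ennreal (2 powr u) * ennreal (diameter (U n) powr u))
        + (\<Sum>n. ennreal (\<eta> * (1/2) ^ Suc n))"
      by (rule suminf_add[symmetric]) auto
    also have "(\<Sum>n. ennreal (\<eta> * (1/2) ^ Suc n)) = ennreal \<eta>"
      using sums_mult[OF power_half_series, of \<eta>] \<eta> by (intro suminf_ennreal_eq) auto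
    also have "(\<Sum>n. ennreal (2 powr u) * ennreal (diameter (U n) powr u))
        = ennreal (2 powr u) * (\<Sum>n. ennreal (diameter (U n) powr u))"
      by simp
    also have "\<dots> \<le> ennreal (2 powr u) * ennreal \<eta>"
      using U(3) by (intro mult_left_mono) auto
    also have "ennreal (2 powr u) * ennreal \<eta> + ennreal \<eta> = ennreal ((2 powr u + 1) * \<eta>)"
      using \<eta> by (simp add: ennreal_mult[symmetric] distrib_right flip: ennreal_plus)
    also have "\<dots> \<le> ennreal (\<epsilon> / 9)" using \<eta>\<epsilon> by (rule ennreal_leI)
    finally show ?thesis using \<open>0 < \<epsilon>\<close> by (simp add: add_right_mono)
  qed
  define I where "I m = {n. \<kappa> n = m}" for m
  have card_J: "card J \<le> \<epsilon> / 9 * (2 powr u) ^ m" if "finite J" "J \<subseteq> I m" for J m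
  proof -
    have "card J * (1 / 2 ^ m) powr u = (\<Sum>n\<in>J. (1 / 2 ^ \<kappa> n) powr u)"
      using that by (subst sum.cong[of J J _ "\<lambda>_. (1 / 2 ^ m) powr u"]) (auto simp: I_def)
    also have "\<dots> \<le> (\<Sum>n\<in>J. w n)" by (intro sum_mono \<kappa>)
    also have "\<dots> \<le> \<epsilon> / 9" using that by (intro sum_w)
    finally have "card J * (1 / 2 ^ m) powr u \<le> \<epsilon> / 9" .
    moreover have "(1 / 2 ^ m) powr u = 1 / (2 powr u) ^ m"
      by (simp add: powr_divide powr_power powr_powr mult.commute flip: powr_realpow)
    ultimately show ?thesis by (simp add: field_simps)
  qed
  have I: "finite (I m)" "card (I m) \<le> \<epsilon> / 9 * (2 powr u) ^ m" for m
  proof -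
    show "finite (I m)"
      using finite_if_finite_subsets_card_bdd[of "I m" "nat \<lfloor>\<epsilon> / 9 * (2 powr u) ^ m\<rfloor>"]
        card_J le_nat_floor by blast
    then show "card (I m) \<le> \<epsilon> / 9 * (2 powr u) ^ m" by (intro card_J) auto
  qed
  have nb: "\<exists>z. dyadic_cell (\<kappa> n) ` U n \<subseteq> neighbour_cells z" for n
  proof (cases "U n = {}")
    case False
    then obtain q where "q \<in> U n" by blast
    have "dyadic_cell (\<kappa> n) p \<in> neighbour_cells (dyadic_cell (\<kappa> n) q)" if "p \<in> U n" for p
      using diameter_bounded_bound[OF U(2) that \<open>q \<in> U n\<close>] \<kappa>(1)[of n] abs_diff_le_dist[of p q]
      by (intro dyadic_cell_in_neighbour_cells) linarith+
    then show ?thesis by blast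
  qed simp
  then have cells: "finite (dyadic_cell (\<kappa> n) ` U n)" "card (dyadic_cell (\<kappa> n) ` U n) \<le> 9" for n
    by (metis neighbour_cells_finite finite_subset, metis neighbour_cells_finite card_mono card_neighbour_cells)
  define Y where "Y m = (\<Union>n\<in>I m. dyadic_cell (\<kappa> n) ` U n)" for m
  show thesis
  proof
    show "finite (Y m)" for m using I cells by (auto simp: Y_def)
    show "card (Y m) \<le> \<epsilon> * (2 powr u) ^ m" for m
    proof -
      have "card (Y m) \<le> (\<Sum>n\<in>I m. card (dyadic_cell (\<kappa> n) ` U n))"
        unfolding Y_def using I by (intro card_UN_le)
      also have "\<dots> \<le> (\<Sum>n\<in>I m. 9)" by (intro sum_mono cells)
      finally have "card (Y m) \<le> 9 * card (I m)" by simp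
      then show ?thesis using I(2)[of m] by linarith
    qed
    show "\<exists>k. dyadic_cell k p \<in> Y k" if p: "p \<in> S" for p
    proof -
      obtain n where "p \<in> U n" using p U(1) by blast
      then have "dyadic_cell (\<kappa> n) p \<in> Y (\<kappa> n)" unfolding Y_def I_def by blast
      then show ?thesis ..
    qed
  qed
qed

section \<open>Incidences between lines and dyadic squares\<close>

definition line_point :: "real \<times> real \<Rightarrow> real \<Rightarrow> real \<times> real" where
  "line_point e x = (x, fst e * x + snd e)"

lemma Icc_fmeasurable: "{a..b::real} \<in> fmeasurable lborel"
  by (rule fmeasurableI) (auto simp: emeasure_lborel_Icc_eq)

text \<open>
  Either the slope \<open>\<alpha>\<close> is at least \<open>d / 2\<close> in absolute value, and the function crosses the strip of
  half-width \<open>\<delta>\<close> in time at most \<open>2 \<delta> / \<bar>\<alpha>\<bar>\<close>; or \<open>\<bar>\<beta>\<bar>\<close> dominates and the function never gets below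
  \<open>d / 2\<close> in absolute value on the unit interval, so either the set is empty or the bound is at
  least 1.
\<close>

lemma measure_nearly_zero_affine_le:
  fixes \<alpha> \<beta> \<delta> d :: real
  assumes "0 < d" "0 \<le> \<delta>" and max: "d \<le> \<bar>\<alpha>\<bar> \<or> d \<le> \<bar>\<beta>\<bar>"
  shows "measure lborel {x\<in>{0..1}. \<bar>\<alpha> * x + \<beta>\<bar> \<le> \<delta>} \<le> 4 * \<delta> / d" (is "measure lborel ?M \<le> _")
proof (cases "d / 2 \<le> \<bar>\<alpha>\<bar>")
  case True
  then have "0 < \<bar>\<alpha>\<bar>" using \<open>0 < d\<close> by linarith
  let ?I = "{- \<beta> / \<alpha> - \<delta> / \<bar>\<alpha>\<bar>..- \<beta> / \<alpha> + \<delta> / \<bar>\<alpha>\<bar>}"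
  have "?M \<subseteq> ?I"
  proof
    fix x assume "x \<in> ?M"
    then have "\<bar>\<alpha> * x + \<beta>\<bar> / \<bar>\<alpha>\<bar> \<le> \<delta> / \<bar>\<alpha>\<bar>"
      by (intro divide_right_mono) auto
    moreover have "\<bar>\<alpha> * x + \<beta>\<bar> / \<bar>\<alpha>\<bar> = \<bar>x - - \<beta> / \<alpha>\<bar>"
      using \<open>0 < \<bar>\<alpha>\<bar>\<close> by (simp add: field_simps flip: abs_divide)
    ultimately show "x \<in> ?I" by (auto simp: abs_le_iff)
  qed
  then have "measure lborel ?M \<le> measure lborel ?I"
    by (intro measure_mono_fmeasurable Icc_fmeasurable) auto
  also have "\<dots> = 2 * \<delta> / \<bar>\<alpha>\<bar>" using \<open>0 \<le> \<delta>\<close> by simp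
  also have "\<dots> \<le> 2 * \<delta> / (d / 2)"
    using True assms by (intro divide_left_mono) auto
  finally show ?thesis by simp
next
  case False
  then have \<beta>: "d \<le> \<bar>\<beta>\<bar>" using max \<open>0 < d\<close> by linarith
  show ?thesis
  proof (cases "d \<le> 2 * \<delta>")
    case True
    have "measure lborel ?M \<le> measure lborel {0..1::real}"
      by (intro measure_mono_fmeasurable Icc_fmeasurable) auto
    also have "\<dots> \<le> 4 * \<delta> / d" using True assms by (simp add: field_simps)
    finally show ?thesis .
  next
    case small: False
    have "?M = {}"
    proof (rule ccontr)
      assume "?M \<noteq> {}"
      then obtain x where x: "0 \<le> x" "x \<le> 1" "\<bar>\<alpha> * x + \<beta>\<bar> \<le> \<delta>" by auto
      have "\<bar>\<alpha> * x\<bar> \<le> \<bar>\<alpha>\<bar>" using x by (simp add: abs_mult mult_left_le)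
      then show False using x \<beta> False small by linarith
    qed
    then have "measure lborel ?M = 0" by (simp only: measure_empty)
    then show ?thesis using assms by simp
  qed
qed

text \<open>
  The bound \<open>4 * 2\<^sup>-\<^sup>k / d\<close>, where \<open>d\<close> is the distance of the parameters, with \<open>d\<close> replaced by a
  dyadic value.  In this form it can be summed over one of the lines by counting, for each \<open>j\<close>,
  the lines at distance at most \<open>2\<^sup>-\<^sup>j\<close>.
\<close>

lemma measure_close_lines_le:
  fixes e e' :: "real \<times> real"
  assumes "dyadic_cell 0 e = dyadic_cell 0 e'"
  shows "measure lborel {x\<in>{0..1}. \<bar>(fst e - fst e') * x + (snd e - snd e')\<bar> \<le> 1 / 2 ^ k}
    \<le> (\<Sum>j\<le>k. 8 * 2 ^ j / 2 ^ k *
          of_bool (\<bar>fst e' - fst e\<bar> \<le> 1 / 2 ^ j \<and> \<bar>snd e' - snd e\<bar> \<le> 1 / 2 ^ j))"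
    (is "measure lborel ?M \<le> (\<Sum>j\<le>k. ?w j)")
proof -
  define d where "d = max \<bar>fst e - fst e'\<bar> \<bar>snd e - snd e'\<bar>"
  have w: "?w j = 8 * 2 ^ j / 2 ^ k" if "d \<le> 1 / 2 ^ j" for j
    using that by (auto simp: d_def abs_minus_commute)
  have one: "?w j \<le> (\<Sum>j\<le>k. ?w j)" if "j \<le> k" for j
    using that by (intro member_le_sum) auto
  show ?thesis
  proof (cases "d \<le> 1 / 2 ^ k")
    case True
    have "measure lborel ?M \<le> measure lborel {0..1::real}"
      by (intro measure_mono_fmeasurable Icc_fmeasurable) auto
    also have "\<dots> \<le> ?w k" using w[OF True] by simp
    finally show ?thesis using one[of k] by linarith
  next
    case False
    define i where "i = (LEAST i. 1 / 2 ^ i < d)"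
    have i: "1 / 2 ^ i < d" unfolding i_def by (rule LeastI[of _ k]) (use False in simp)
    have "i \<le> k" unfolding i_def by (rule Least_le) (use False in simp)
    have "d < 1" using same_dyadic_cell_abs_diff_less[OF assms] by (simp add: d_def)
    then have "i \<noteq> 0" using i by (intro notI) simp
    then obtain j where j: "i = Suc j" using not0_implies_Suc by blast
    have dj: "d \<le> 1 / 2 ^ j" using not_less_Least[of j "\<lambda>m. 1 / 2 ^ m < d"] j unfolding i_def by simp
    have "0 < d" using i by (rule le_less_trans[rotated]) simp
    have "measure lborel ?M \<le> 4 * (1 / 2 ^ k) / d"
      using \<open>0 < d\<close> by (intro measure_nearly_zero_affine_le) (auto simp: d_def)
    also have "\<dots> \<le> 4 * (1 / 2 ^ k) / (1 / 2 ^ i)"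
      using i by (intro divide_left_mono) (auto simp: \<open>0 < d\<close>)
    also have "\<dots> = ?w j" using w[OF dj] j by simp
    finally show ?thesis using one[of j] j \<open>i \<le> k\<close> by linarith
  qed
qed

text \<open>
  At most \<open>9 t\<^bsup>k - j\<^esup>\<close> lines are at distance at most \<open>2\<^sup>-\<^sup>j\<close>, so the sum is dominated by a
  geometric series with ratio \<open>t / 2\<close>.  Here the exponent \<open>s\<close> being less than 1 enters, as
  \<open>t = 2\<^sup>s < 2\<close>.
\<close>

lemma sum_measure_close_lines_le:
  fixes P :: "(real \<times> real) set" and t :: real
  assumes "finite P" and cell0: "\<And>p. p \<in> P \<Longrightarrow> dyadic_cell 0 p = z0" and "e \<in> P"
    and t: "1 \<le> t" "t < 2"
    and reg: "\<And>j z. j \<le> k \<Longrightarrow> card {p\<in>P. dyadic_cell j p = z} \<le> t ^ (k - j)"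
  shows "(\<Sum>e'\<in>P. measure lborel
      {x\<in>{0..1}. \<bar>(fst e - fst e') * x + (snd e - snd e')\<bar> \<le> 1 / 2 ^ k}) \<le> 144 / (2 - t)"
proof -
  define N where "N j = {p\<in>P. \<bar>fst p - fst e\<bar> \<le> 1 / 2 ^ j \<and> \<bar>snd p - snd e\<bar> \<le> 1 / 2 ^ j}" for j :: nat
  have N: "card (N j) \<le> 9 * t ^ (k - j)" if "j \<le> k" for j
  proof -
    have "N j \<subseteq> (\<Union>z\<in>neighbour_cells (dyadic_cell j e). {p\<in>P. dyadic_cell j p = z})"
      unfolding N_def using dyadic_cell_in_neighbour_cells[of _ e j] by blast
    then have "card (N j) \<le> card (\<Union>z\<in>neighbour_cells (dyadic_cell j e). {p\<in>P. dyadic_cell j p = z})"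
      using \<open>finite P\<close> neighbour_cells_finite by (intro card_mono) auto
    also have "\<dots> \<le> (\<Sum>z\<in>neighbour_cells (dyadic_cell j e). card {p\<in>P. dyadic_cell j p = z})"
      using neighbour_cells_finite by (intro card_UN_le)
    finally have "card (N j) \<le> (\<Sum>z\<in>neighbour_cells (dyadic_cell j e). real (card {p\<in>P. dyadic_cell j p = z}))"
      by (simp flip: of_nat_sum)
    also have "\<dots> \<le> (\<Sum>z\<in>neighbour_cells (dyadic_cell j e). t ^ (k - j))"
      using that by (intro sum_mono reg)
    finally show ?thesis by (simp add: card_neighbour_cells)
  qed
  have cardN: "real (card (N j)) =
      (\<Sum>e'\<in>P. of_bool (\<bar>fst e' - fst e\<bar> \<le> 1 / 2 ^ j \<and> \<bar>snd e' - snd e\<bar> \<le> 1 / 2 ^ j))" for j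
    using \<open>finite P\<close> by (simp add: N_def Int_def)
  have "(\<Sum>e'\<in>P. measure lborel
      {x\<in>{0..1}. \<bar>(fst e - fst e') * x + (snd e - snd e')\<bar> \<le> 1 / 2 ^ k})
    \<le> (\<Sum>e'\<in>P. \<Sum>j\<le>k. 8 * 2 ^ j / 2 ^ k *
          of_bool (\<bar>fst e' - fst e\<bar> \<le> 1 / 2 ^ j \<and> \<bar>snd e' - snd e\<bar> \<le> 1 / 2 ^ j))"
    using cell0 \<open>e \<in> P\<close> by (intro sum_mono measure_close_lines_le) simp
  also have "\<dots> = (\<Sum>j\<le>k. 8 * 2 ^ j / 2 ^ k * card (N j))"
    by (subst sum.swap) (simp only: cardN sum_distrib_left)
  also have "\<dots> \<le> (\<Sum>j\<le>k. 8 * 2 ^ j / 2 ^ k * (9 * t ^ (k - j)))"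
    using N by (intro sum_mono mult_left_mono) auto
  also have "\<dots> = (\<Sum>j\<le>k. 72 * (t / 2) ^ (k - j))"
    by (intro sum.cong) (auto simp: power_divide power_diff)
  also have "\<dots> = 72 * (\<Sum>i\<le>k. (t / 2) ^ i)"
    unfolding sum_distrib_left
    by (rule sum.reindex_bij_witness[of _ "\<lambda>i. k - i" "\<lambda>i. k - i"]) auto
  also have "\<dots> \<le> 72 * (1 / (1 - t / 2))"
  proof -
    have "(\<Sum>i\<le>k. (t / 2) ^ i) \<le> (\<Sum>i. (t / 2) ^ i)"
      using t by (intro sum_le_suminf summable_geometric) auto
    then show ?thesis using t by (simp add: suminf_geometric)
  qed
  also have "\<dots> = 144 / (2 - t)" using t by (simp add: field_simps)
  finally show ?thesis .
qed

text \<open>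
  The Cauchy-Schwarz inequality between the sizes of the fibres of \<open>\<phi>\<close> over \<open>Y\<close> and the number of
  pairs in a common fibre.  The parameter \<open>l\<close> makes the right-hand side linear in both
  quantities, so that it can be integrated over a family of maps \<open>\<phi>\<close> without a further use of the
  Cauchy-Schwarz inequality.
\<close>

lemma card_vimage_le_pairs:
  fixes l :: real
  assumes "finite P" "finite Y" "0 < l"
  shows "card {e\<in>P. \<phi> e \<in> Y} \<le> l / 2 * card Y + (\<Sum>e\<in>P. \<Sum>e'\<in>P. of_bool (\<phi> e = \<phi> e')) / (2 * l)"
proof -
  define f where "f y = (\<Sum>e\<in>P. of_bool (\<phi> e = y) :: real)" for y
  have "{e\<in>P. \<phi> e \<in> Y} = (\<Union>y\<in>Y. {e\<in>P. \<phi> e = y})" by auto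
  then have "card {e\<in>P. \<phi> e \<in> Y} \<le> (\<Sum>y\<in>Y. card {e\<in>P. \<phi> e = y})"
    using card_UN_le[OF \<open>finite Y\<close>] by simp
  then have "card {e\<in>P. \<phi> e \<in> Y} \<le> (\<Sum>y\<in>Y. real (card {e\<in>P. \<phi> e = y}))"
    by (simp flip: of_nat_sum)
  also have "\<dots> = (\<Sum>y\<in>Y. f y)"
    using \<open>finite P\<close> by (simp add: f_def Int_def)
  also have "\<dots> \<le> (\<Sum>y\<in>Y. l / 2 + f y * f y / (2 * l))"
  proof (intro sum_mono)
    fix y
    \<comment> \<open>The inequality of arithmetic and geometric means for \<open>l\<close> and \<open>(f y)\<^sup>2 / l\<close>.\<close>
    have "0 \<le> (f y - l) * (f y - l)" by simp
    then show "f y \<le> l / 2 + f y * f y / (2 * l)"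
      using \<open>0 < l\<close> by (simp add: field_simps)
  qed
  also have "\<dots> = l / 2 * card Y + (\<Sum>y\<in>Y. f y * f y) / (2 * l)"
    by (simp add: sum.distrib flip: sum_divide_distrib)
  also have "(\<Sum>y\<in>Y. f y * f y)
      = (\<Sum>y\<in>Y. \<Sum>e\<in>P. \<Sum>e'\<in>P. of_bool (\<phi> e = y) * of_bool (\<phi> e' = y))"
    by (simp add: f_def sum_product)
  also have "\<dots> = (\<Sum>e\<in>P. \<Sum>e'\<in>P. \<Sum>y\<in>Y. of_bool (\<phi> e = y) * of_bool (\<phi> e' = y))"
    by (subst sum.swap) (intro sum.cong refl sum.swap)
  also have "\<dots> \<le> (\<Sum>e\<in>P. \<Sum>e'\<in>P. of_bool (\<phi> e = \<phi> e'))"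
  proof (intro sum_mono)
    fix e e'
    have "(\<Sum>y\<in>Y. of_bool (\<phi> e = y) * of_bool (\<phi> e' = y) :: real)
        = (\<Sum>y\<in>Y. if y = \<phi> e then of_bool (\<phi> e = \<phi> e') else 0)"
      by (intro sum.cong) auto
    also have "\<dots> \<le> of_bool (\<phi> e = \<phi> e')" using \<open>finite Y\<close> by simp
    finally show "(\<Sum>y\<in>Y. of_bool (\<phi> e = y) * of_bool (\<phi> e' = y) :: real) \<le> of_bool (\<phi> e = \<phi> e')" .
  qed
  finally show ?thesis using \<open>0 < l\<close> by (simp add: divide_right_mono)
qed

definition cell_times :: "nat \<Rightarrow> (int \<times> int) set \<Rightarrow> real \<times> real \<Rightarrow> real set" where
  "cell_times k Y e = {x\<in>{0..1}. dyadic_cell k (line_point e x) \<in> Y}"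

lemma cell_times_measurable: "cell_times k Y e \<in> sets lborel"
proof -
  have "cell_times k Y e = (\<Union>z\<in>Y. {x\<in>{0..1}. \<lfloor>2 ^ k * x\<rfloor> = fst z \<and>
      \<lfloor>2 ^ k * (fst e * x + snd e)\<rfloor> = snd z})"
    by (auto simp: cell_times_def dyadic_cell_def line_point_def)
  also have "\<dots> \<in> sets lborel"
    by (rule sets.countable_UN'', simp, measurable)
  finally show ?thesis .
qed

lemma subset_Icc_fmeasurable: "A \<in> sets lborel \<Longrightarrow> A \<subseteq> {a..b::real} \<Longrightarrow> A \<in> fmeasurable lborel"
  by (rule fmeasurableI2[OF Icc_fmeasurable])

lemma measure_floor_level_le:
  "measure lborel {x\<in>{0..1::real}. \<lfloor>2 ^ k * x\<rfloor> = i} \<le> 1 / 2 ^ k"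
proof -
  let ?I = "{of_int i / 2 ^ k..(of_int i + 1) / 2 ^ k :: real}"
  have "{x\<in>{0..1::real}. \<lfloor>2 ^ k * x\<rfloor> = i} \<subseteq> ?I"
  proof
    fix x :: real assume "x \<in> {x\<in>{0..1}. \<lfloor>2 ^ k * x\<rfloor> = i}"
    then have "of_int i \<le> 2 ^ k * x" "2 ^ k * x \<le> of_int i + 1" by auto
    then show "x \<in> ?I" by (simp add: field_simps)
  qed
  then have "measure lborel {x\<in>{0..1::real}. \<lfloor>2 ^ k * x\<rfloor> = i} \<le> measure lborel ?I"
    by (intro measure_mono_fmeasurable Icc_fmeasurable) auto
  also have "\<dots> = 1 / 2 ^ k" by (simp add: field_simps)
  finally show ?thesis .
qed

text \<open>
  Cordoba's argument.  At a time \<open>x\<close>, only the squares of \<open>Y\<close> in the column over \<open>x\<close> can be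
  occupied, and two lines in the same square are within \<open>2\<^sup>-\<^sup>k\<close> of each other.  Apply
  \<open>card_vimage_le_pairs\<close> at each time and integrate: the left-hand side becomes the total time
  spent in the squares, the first term on the right becomes \<open>2\<^sup>-\<^sup>k\<close> times the number of squares,
  and the second term is controlled by \<open>sum_measure_close_lines_le\<close>.
\<close>

lemma card_regular_lines_le:
  fixes P :: "(real \<times> real) set" and t c :: real
  assumes fin: "finite P" "finite Y" and cell0: "\<And>p. p \<in> P \<Longrightarrow> dyadic_cell 0 p = z0"
    and t: "1 \<le> t" "t < 2" and "0 < c"
    and reg: "\<And>j z. j \<le> k \<Longrightarrow> card {p\<in>P. dyadic_cell j p = z} \<le> t ^ (k - j)"
    and time: "\<And>e. e \<in> P \<Longrightarrow> c \<le> measure lborel (cell_times k Y e)"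
  shows "card P \<le> 144 / (2 - t) * card Y / (2 ^ k * c\<^sup>2)"
proof -
  define K where "K = 144 / (2 - t)"
  have "0 < K" using t by (simp add: K_def)
  \<comment> \<open>With this choice the second term is at most half of \<open>card P * c\<close> and can be absorbed.\<close>
  define l where "l = K / c"
  have "0 < l" using \<open>0 < K\<close> \<open>0 < c\<close> by (simp add: l_def)
  define J where "J y = {x\<in>{0..1::real}. \<lfloor>2 ^ k * x\<rfloor> = fst y}" for y :: "int \<times> int"
  define M where "M e e' = {x\<in>{0..1}. \<bar>(fst e - fst e') * x + (snd e - snd e')\<bar> \<le> 1 / 2 ^ k}"
    for e e' :: "real \<times> real"
  have JM: "J y \<in> fmeasurable lborel" "M e e' \<in> fmeasurable lborel" for y e e'
    by (auto simp: J_def M_def intro!: subset_Icc_fmeasurable[of _ 0 1])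
  have T: "cell_times k Y e \<in> fmeasurable lborel" for e
    using cell_times_measurable by (rule subset_Icc_fmeasurable[of _ 0 1]) (auto simp: cell_times_def)
  define g where "g x = (\<Sum>e\<in>P. indicator (cell_times k Y e) x :: real)" for x
  define h where "h x = l / 2 * (\<Sum>y\<in>Y. indicator (J y) x)
      + (\<Sum>e\<in>P. \<Sum>e'\<in>P. indicator (M e e') x) / (2 * l)" for x :: real
  have int_ind: "integrable lborel (indicator A :: real \<Rightarrow> real)"
    "integral\<^sup>L lborel (indicator A) = measure lborel A"
    if "A \<in> fmeasurable lborel" for A
    using that fmeasurableD2[of A lborel]
    by (auto simp: fmeasurable_def integrable_indicator_iff less_top)
  have pointwise: "g x \<le> h x" for x
  proof (cases "x \<in> {0..1}")
    case False
    then have "g x = 0" "0 \<le> h x"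
      using \<open>0 < l\<close> by (auto simp: g_def h_def cell_times_def indicator_def intro!: sum_nonneg add_nonneg_nonneg divide_nonneg_nonneg mult_nonneg_nonneg)
    then show ?thesis by simp
  next
    case True
    define Y' where "Y' = {y\<in>Y. x \<in> J y}"
    let ?\<phi> = "\<lambda>e. dyadic_cell k (line_point e x)"
    have "g x = (\<Sum>e\<in>P. of_bool (?\<phi> e \<in> Y'))"
      unfolding g_def using True
      by (intro sum.cong) (auto simp: Y'_def J_def cell_times_def indicator_def dyadic_cell_def line_point_def)
    also have "\<dots> = card {e\<in>P. ?\<phi> e \<in> Y'}"
      using fin by (simp add: Int_def)
    also have "\<dots> \<le> l / 2 * card Y' + (\<Sum>e\<in>P. \<Sum>e'\<in>P. of_bool (?\<phi> e = ?\<phi> e')) / (2 * l)"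
      using fin \<open>0 < l\<close> by (intro card_vimage_le_pairs) (auto simp: Y'_def)
    also have "\<dots> \<le> l / 2 * card Y' + (\<Sum>e\<in>P. \<Sum>e'\<in>P. indicator (M e e') x) / (2 * l)"
    proof -
      have "of_bool (?\<phi> e = ?\<phi> e') \<le> (indicator (M e e') x :: real)" for e e'
      proof (cases "?\<phi> e = ?\<phi> e'")
        case eq: True
        have "\<bar>(fst e * x + snd e) - (fst e' * x + snd e')\<bar> < 1 / 2 ^ k"
          using same_dyadic_cell_abs_diff_less(2)[OF eq] by (simp add: line_point_def)
        moreover have "(fst e * x + snd e) - (fst e' * x + snd e')
            = (fst e - fst e') * x + (snd e - snd e')"
          by (simp add: algebra_simps)
        ultimately have "x \<in> M e e'" using True by (simp add: M_def)
        then show ?thesis by simp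
      qed simp
      then show ?thesis
        using \<open>0 < l\<close> by (intro add_left_mono divide_right_mono sum_mono) auto
    qed
    also have "real (card Y') = (\<Sum>y\<in>Y. indicator (J y) x)"
      using fin by (simp add: Y'_def indicator_def Int_def of_bool_def[symmetric])
    finally show ?thesis by (simp add: h_def)
  qed
  have "card P * c = (\<Sum>e\<in>P. c)" by simp
  also have "\<dots> \<le> (\<Sum>e\<in>P. measure lborel (cell_times k Y e))"
    by (intro sum_mono time)
  also have "\<dots> = integral\<^sup>L lborel g"
    unfolding g_def using T int_ind by (subst Bochner_Integration.integral_sum) auto
  also have "\<dots> \<le> integral\<^sup>L lborel h"
    using T JM int_ind pointwise
    by (intro integral_mono) (auto simp: g_def[abs_def] h_def[abs_def])
  also have "\<dots> = l / 2 * (\<Sum>y\<in>Y. measure lborel (J y)) + (\<Sum>e\<in>P. \<Sum>e'\<in>P. measure lborel (M e e')) / (2 * l)"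
    unfolding h_def using JM int_ind by simp
  also have "\<dots> \<le> l / 2 * (\<Sum>y\<in>Y. 1 / 2 ^ k) + (\<Sum>e\<in>P. K) / (2 * l)"
  proof (intro add_mono mult_left_mono divide_right_mono sum_mono)
    show "measure lborel (J y) \<le> 1 / 2 ^ k" for y
      unfolding J_def by (rule measure_floor_level_le)
    show "(\<Sum>e'\<in>P. measure lborel (M e e')) \<le> K" if "e \<in> P" for e
      unfolding M_def K_def using fin(1) cell0 that t reg by (rule sum_measure_close_lines_le)
  qed (use \<open>0 < l\<close> in auto)
  also have "\<dots> = K * card Y / (2 * c * 2 ^ k) + card P * c / 2"
    using \<open>0 < K\<close> \<open>0 < c\<close> by (simp add: l_def field_simps)
  finally have "card P * c \<le> K * card Y / (c * 2 ^ k)" by (simp add: field_simps)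
  then have "card P \<le> K * card Y / (c * 2 ^ k) / c"
    using \<open>0 < c\<close> by (subst pos_le_divide_eq)
  then show ?thesis by (simp add: K_def power2_eq_square ac_simps)
qed

text \<open>
  Every line spends total time at least 1 in a dyadic cover of \<open>S\<close>, hence time at least \<open>c q\<^sup>k\<close> in the
  squares of some level \<open>k\<close>, as \<open>c\<close> is chosen with \<open>\<Sum>k. c q\<^sup>k = 1/2\<close>.  Let \<open>D k\<close> be the set of
  the lines for which level \<open>k\<close> works.  A regular subset of \<open>D k\<close> bounds the content of \<open>D k\<close> by a
  multiple of \<open>\<epsilon> (\<rho> / q\<^sup>2)\<^sup>k\<close>, where \<open>\<rho> = 2\<^bsup>u - 1 - s\<^esup> < 1\<close>.  With \<open>q = \<rho>\<^bsup>1/4\<^esup>\<close> this is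
  summable over \<open>k\<close>, and the sum is proportional to \<open>\<epsilon>\<close>.
\<close>

lemma hausdorff_content_lines_eq_0:
  fixes S :: "(real \<times> real) set"
  assumes null: "hausdorff_content u S = 0" and u: "1 < u" "u - 1 < s" "s < 1"
  shows "hausdorff_content s {e. \<forall>x\<in>{0..1}. line_point e x \<in> S} = 0"
proof -
  define t where "t = 2 powr s"
  have "0 < s" using u by simp
  have t: "1 \<le> t" "t < 2"
    using u \<open>0 < s\<close> powr_less_mono[of s 1 2] by (auto simp: t_def ge_one_powr_ge_zero)
  define \<rho> where "\<rho> = 2 powr u / (2 * t)"
  have "\<rho> = 2 powr (u - (1 + s))"
    by (simp add: \<rho>_def t_def powr_diff powr_add)
  also have "\<dots> < 2 powr 0" using u by (intro powr_less_mono) auto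
  finally have \<rho>: "0 < \<rho>" "\<rho> < 1" using t by (auto simp: \<rho>_def)
  define \<kappa> where "\<kappa> = sqrt \<rho>"
  have \<kappa>: "0 < \<kappa>" "\<kappa> < 1" "\<kappa> * \<kappa> = \<rho>" using \<rho> by (auto simp: \<kappa>_def)
  define q where "q = sqrt \<kappa>"
  have q: "0 < q" "q < 1" "q * q = \<kappa>" using \<kappa> by (auto simp: q_def)
  define c where "c = (1 - q) / 2"
  have "0 < c" using q by (simp add: c_def)
  define C where "C = 4 * (144 / (2 - t)) / (c\<^sup>2 * (1 - \<kappa>))"
  have "0 < C" using t \<kappa> \<open>0 < c\<close> by (simp add: C_def)
  \<comment> \<open>Regular subsets are taken inside a single unit square of the parameter plane.\<close>
  define E where "E z = {e. (\<forall>x\<in>{0..1}. line_point e x \<in> S) \<and> dyadic_cell 0 e = z}" for z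
  have "hausdorff_content s (E z) = 0" for z
  proof (rule hausdorff_content_eq_0I[OF \<open>0 < C\<close>])
    fix \<epsilon> :: real assume "0 < \<epsilon>"
    obtain Y where Y: "\<And>k. finite (Y k)" "\<And>k. card (Y k) \<le> \<epsilon> * (2 powr u) ^ k"
      "\<And>p. p \<in> S \<Longrightarrow> \<exists>k. dyadic_cell k p \<in> Y k"
      using dyadic_cover[OF null _ \<open>0 < \<epsilon>\<close>] u by (metis less_trans zero_less_one)
    define D where "D k = {e \<in> E z. c * q ^ k \<le> measure lborel (cell_times k (Y k) e)}" for k
    have "E z \<subseteq> (\<Union>k. D k)"
    proof
      fix e assume "e \<in> E z"
      show "e \<in> (\<Union>k. D k)"
      proof (rule ccontr)
        assume "e \<notin> (\<Union>k. D k)"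
        then have less: "measure lborel (cell_times k (Y k) e) \<le> c * q ^ k" for k
          using \<open>e \<in> E z\<close> by (auto simp: D_def not_le intro: less_imp_le)
        have "{0..1} \<subseteq> (\<Union>k. cell_times k (Y k) e)"
          using \<open>e \<in> E z\<close> Y(3) unfolding E_def cell_times_def by blast
        then have "emeasure lborel {0..1::real} \<le> emeasure lborel (\<Union>k. cell_times k (Y k) e)"
          using cell_times_measurable by (intro emeasure_mono sets.countable_UN) blast+
        also have "\<dots> \<le> (\<Sum>k. emeasure lborel (cell_times k (Y k) e))"
          using cell_times_measurable by (intro emeasure_subadditive_countably) blast
        also have "\<dots> \<le> (\<Sum>k. ennreal (c * q ^ k))"
        proof (intro suminf_le)
          fix k
          have "cell_times k (Y k) e \<in> fmeasurable lborel"
            using cell_times_measurable by (rule subset_Icc_fmeasurable[of _ 0 1]) (auto simp: cell_times_def)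
          then show "emeasure lborel (cell_times k (Y k) e) \<le> ennreal (c * q ^ k)"
            using less by (simp add: emeasure_eq_measure2 ennreal_leI)
        qed auto
        also have "\<dots> = ennreal (c * (1 / (1 - q)))"
          using q \<open>0 < c\<close> geometric_sums[of q]
          by (intro suminf_ennreal_eq sums_mult) auto
        also have "c * (1 / (1 - q)) = 1 / 2" using q by (simp add: c_def)
        also have "emeasure lborel {0..1::real} = ennreal 1" by simp
        finally have "(1::real) \<le> 1 / 2" by (subst (asm) ennreal_le_iff) auto
        then show False by simp
      qed
    qed
    then have "hausdorff_content s (E z) \<le> hausdorff_content s (\<Union>k. D k)"
      by (rule hausdorff_content_mono)
    also have "\<dots> \<le> (\<Sum>k. hausdorff_content s (D k))"
      by (rule hausdorff_content_UN_le)
    also have "\<dots> \<le> (\<Sum>k. ennreal (4 * (144 / (2 - t)) * \<epsilon> / c\<^sup>2 * \<kappa> ^ k))"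
    proof (intro suminf_le)
      fix k
      have cell0: "dyadic_cell 0 p = z" if "p \<in> D k" for p
        using that by (simp add: D_def E_def)
      obtain P where P: "finite P" "P \<subseteq> D k"
        "\<And>j z. j \<le> k \<Longrightarrow> card {p\<in>P. dyadic_cell j p = z} \<le> t ^ (k - j)"
        "hausdorff_content s (D k) \<le> ennreal (4 * card P / t ^ k)"
        using regular_net[OF cell0 \<open>0 < s\<close> less_imp_le[OF \<open>s < 1\<close>] t_def, where k = k] by blast
      have "card P \<le> 144 / (2 - t) * card (Y k) / (2 ^ k * (c * q ^ k)\<^sup>2)"
        using P(1) Y(1) cell0 t _ P(3)
      proof (rule card_regular_lines_le)
        show "0 < c * q ^ k" using \<open>0 < c\<close> q by simp
      qed (use P(2) in \<open>auto simp: D_def\<close>)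
      also have "\<dots> \<le> 144 / (2 - t) * (\<epsilon> * (2 powr u) ^ k) / (2 ^ k * (c * q ^ k)\<^sup>2)"
        using Y(2) t by (intro divide_right_mono mult_left_mono) auto
      finally have "4 * card P / t ^ k
          \<le> 4 * (144 / (2 - t) * (\<epsilon> * (2 powr u) ^ k) / (2 ^ k * (c * q ^ k)\<^sup>2)) / t ^ k"
        using t by (intro divide_right_mono mult_left_mono) auto
      also have "\<dots> = 4 * (144 / (2 - t)) * \<epsilon> / c\<^sup>2 * (\<rho> ^ k / (q * q) ^ k)"
        by (simp add: \<rho>_def power_divide power_mult_distrib power2_eq_square mult_ac)
      also have "\<rho> ^ k / (q * q) ^ k = \<kappa> ^ k"
        using \<kappa> q by (simp add: power_mult_distrib flip: \<kappa>(3))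
      finally show "hausdorff_content s (D k) \<le> ennreal (4 * (144 / (2 - t)) * \<epsilon> / c\<^sup>2 * \<kappa> ^ k)"
        using P(4) by (meson ennreal_leI order_trans)
    qed auto
    also have "\<dots> = ennreal (4 * (144 / (2 - t)) * \<epsilon> / c\<^sup>2 * (1 / (1 - \<kappa>)))"
      using \<kappa> t \<open>0 < \<epsilon>\<close> geometric_sums[of \<kappa>]
      by (intro suminf_ennreal_eq sums_mult) auto
    also have "4 * (144 / (2 - t)) * \<epsilon> / c\<^sup>2 * (1 / (1 - \<kappa>)) = C * \<epsilon>"
      by (simp add: C_def)
    finally show "hausdorff_content s (E z) \<le> ennreal (C * \<epsilon>)" .
  qed
  then have "hausdorff_content s (\<Union>z. E z) = 0"
    by (intro hausdorff_content_eq_0_UN) auto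
  moreover have "(\<Union>z. E z) = {e. \<forall>x\<in>{0..1}. line_point e x \<in> S}" by (auto simp: E_def)
  ultimately show ?thesis by simp
qed

section \<open>Lines covering a graph\<close>

lemma line_through_point:
  assumes "is_line l" "(x0, y0) \<in> l"
  obtains (graph) a where "\<And>x. line_point (a, y0 - a * x0) x \<in> l"
    | (vertical) "\<And>y. (x0, y) \<in> l"
proof -
  have "affine l" and dim: "aff_dim l = 1" using assms(1) by (auto simp: is_line_def)
  have "l \<noteq> {(x0, y0)}" using dim by auto
  then obtain x1 y1 where q: "(x1, y1) \<in> l" "(x1, y1) \<noteq> (x0, y0)" using assms(2) by auto
  have on: "(x0 + v * (x1 - x0), y0 + v * (y1 - y0)) \<in> l" for v
  proof -
    have "(1 - v) *\<^sub>R (x0, y0) + v *\<^sub>R (x1, y1) \<in> l"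
      using \<open>affine l\<close> assms(2) q(1) by (intro mem_affine) auto
    then show ?thesis by (simp add: algebra_simps)
  qed
  show thesis
  proof (cases "x1 = x0")
    case True
    then have "y1 \<noteq> y0" using q by simp
    have "(x0, y) \<in> l" for y
      using on[of "(y - y0) / (y1 - y0)"] True \<open>y1 \<noteq> y0\<close> by simp
    then show thesis by (rule vertical)
  next
    case False
    define a where "a = (y1 - y0) / (x1 - x0)"
    have "line_point (a, y0 - a * x0) x \<in> l" for x
    proof -
      have "x0 + (x - x0) / (x1 - x0) * (x1 - x0) = x" using False by simp
      moreover have "y0 + (x - x0) / (x1 - x0) * (y1 - y0) = a * x + (y0 - a * x0)"
      proof -
        have "(x - x0) / (x1 - x0) * (y1 - y0) = a * (x - x0)" by (simp add: a_def)
        then show ?thesis by (simp add: right_diff_distrib)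
      qed
      ultimately show ?thesis
        using on[of "(x - x0) / (x1 - x0)"] by (simp only: line_point_def fst_conv snd_conv)
    qed
    then show thesis by (rule graph)
  qed
qed

text \<open>
  If \<open>a \<noteq> F' x\<close>, there is \<open>n\<close> such that for \<open>\<bar>y - x\<bar> < 1 / (n + 1)\<close> the graph over \<open>y\<close> is at least
  \<open>\<bar>y - x\<bar> / (n + 1)\<close> away from the line through \<open>(x, F x)\<close> of slope \<open>a\<close>.  If \<open>y\<close> is the foot of
  another line, this vertical distance is at most a constant multiple of the distance of the
  parameters of the two lines.  So for fixed \<open>n\<close>, on each interval of length \<open>1 / (n + 1)\<close>, the foot
  is a Lipschitz function of the line, and countably many such pieces cover all the feet.
\<close>

lemma transversal_feet_null:
  fixes F F' :: "real \<Rightarrow> real"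
  assumes null: "hausdorff_content 1 E = 0"
    and deriv: "\<And>x. x \<in> {0..1} \<Longrightarrow> (F has_real_derivative F' x) (at x within {0..1})"
  shows "hausdorff_content 1 {x\<in>{0..1}. \<exists>a. a \<noteq> F' x \<and> (a, F x - a * x) \<in> E} = 0"
proof -
  define R where "R n x e \<longleftrightarrow> e \<in> E \<and> snd e = F x - fst e * x \<and>
    (\<forall>y\<in>{0..1}. \<bar>y - x\<bar> < 1 / real (Suc n) \<longrightarrow> \<bar>y - x\<bar> \<le> Suc n * \<bar>F y - F x - fst e * (y - x)\<bar>)"
    for n x e
  define A where "A n i = {x\<in>{0..1}. \<lfloor>real (Suc n) * x\<rfloor> = i \<and> (\<exists>e\<in>E. R n x e)}" for n i
  have piece: "hausdorff_content 1 (A n i) = 0" for n i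
  proof (rule hausdorff_content_eq_0_relation[OF null zero_less_one])
    show "\<exists>e\<in>E. R n x e" if "x \<in> A n i" for x using that by (simp add: A_def)
    show "0 < 2 * real (Suc n)" by simp
    fix x y e e' assume xy: "x \<in> A n i" "y \<in> A n i" and e: "R n x e" "R n y e'"
    have 01: "x \<in> {0..1}" "y \<in> {0..1}" using xy by (auto simp: A_def)
    have "\<bar>real (Suc n) * y - real (Suc n) * x\<bar> < 1" using xy by (simp add: A_def) linarith
    then have "real (Suc n) * \<bar>y - x\<bar> < 1"
      by (simp add: abs_mult flip: right_diff_distrib)
    then have "\<bar>y - x\<bar> < 1 / real (Suc n)" by (simp add: field_simps)
    then have "\<bar>y - x\<bar> \<le> Suc n * \<bar>F y - F x - fst e * (y - x)\<bar>"
      using e(1) 01 by (simp add: R_def)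
    moreover have "F y - F x - fst e * (y - x) = (fst e' - fst e) * y + (snd e' - snd e)"
      using e by (simp add: R_def algebra_simps)
    moreover have "\<bar>(fst e' - fst e) * y + (snd e' - snd e)\<bar> \<le> 2 * dist e e'"
    proof -
      have "\<bar>(fst e' - fst e) * y\<bar> \<le> \<bar>fst e' - fst e\<bar>"
        using 01 by (simp add: abs_mult mult_left_le)
      then show ?thesis using abs_diff_le_dist[of e e'] by linarith
    qed
    ultimately have "\<bar>y - x\<bar> \<le> Suc n * (2 * dist e e')"
      by (smt (verit) mult_left_mono of_nat_0_le_iff)
    then show "dist x y \<le> 2 * real (Suc n) * dist e e'"
      by (simp only: dist_real_def abs_minus_commute[of x y] mult.assoc mult.left_commute[of 2])
  qed
  have "hausdorff_content 1 (\<Union>(n, i)\<in>UNIV. A n i) = 0"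
    by (rule hausdorff_content_eq_0_UN) (auto simp: piece)
  moreover have "{x\<in>{0..1}. \<exists>a. a \<noteq> F' x \<and> (a, F x - a * x) \<in> E} \<subseteq> (\<Union>(n, i)\<in>UNIV. A n i)"
  proof clarify
    fix x a assume x: "x \<in> {0..1}" and a: "a \<noteq> F' x" and e: "(a, F x - a * x) \<in> E"
    define d where "d = \<bar>F' x - a\<bar> / 2"
    have "0 < d" using a by (simp add: d_def)
    have "((\<lambda>y. (F y - F x) / (y - x)) \<longlongrightarrow> F' x) (at x within {0..1})"
      using deriv[OF x] by (simp add: has_field_derivative_iff)
    then obtain r where r: "0 < r" "\<And>y. y \<in> {0..1} \<Longrightarrow> y \<noteq> x \<Longrightarrow> \<bar>y - x\<bar> < r \<Longrightarrow>
        \<bar>(F y - F x) / (y - x) - F' x\<bar> < d"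
      using \<open>0 < d\<close> unfolding tendsto_iff eventually_at dist_real_def by blast
    obtain n where n: "1 / min r d < real n"
      using reals_Archimedean2 by blast
    have "0 < min r d" using r \<open>0 < d\<close> by simp
    then have "1 / real (Suc n) < min r d"
      using n by (simp add: field_simps del: min_less_iff_conj)
    then have n: "1 / real (Suc n) < r" "1 / real (Suc n) < d" by auto
    have away: "d < \<bar>p - a\<bar>" if "\<bar>p - F' x\<bar> < d" for p
      using that unfolding d_def by (smt (verit) field_sum_of_halves)
    have "\<bar>y - x\<bar> \<le> Suc n * \<bar>F y - F x - a * (y - x)\<bar>"
      if y: "y \<in> {0..1}" "\<bar>y - x\<bar> < 1 / real (Suc n)" for y
    proof (cases "y = x")
      case False
      then have "\<bar>(F y - F x) / (y - x) - F' x\<bar> < d" using r(2) y n by simp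
      then have "d < \<bar>(F y - F x) / (y - x) - a\<bar>" by (rule away)
      then have "d * \<bar>y - x\<bar> \<le> \<bar>(F y - F x) / (y - x) - a\<bar> * \<bar>y - x\<bar>"
        by (intro mult_right_mono) auto
      also have "\<dots> = \<bar>F y - F x - a * (y - x)\<bar>"
      proof -
        have "((F y - F x) / (y - x) - a) * (y - x) = F y - F x - a * (y - x)"
          using False by (simp add: field_simps)
        then show ?thesis by (metis abs_mult)
      qed
      finally have "1 / real (Suc n) * \<bar>y - x\<bar> \<le> \<bar>F y - F x - a * (y - x)\<bar>"
        using n(2) by (meson abs_ge_zero less_imp_le mult_right_mono order_trans)
      then show ?thesis by (simp add: field_simps)
    qed simp
    then have "R n x (a, F x - a * x)" using e by (simp add: R_def)
    then have "x \<in> A n \<lfloor>real (Suc n) * x\<rfloor>" using x e by (auto simp: A_def)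
    then show "x \<in> (\<Union>(n, i)\<in>UNIV. A n i)" by auto
  qed
  ultimately show ?thesis by (rule hausdorff_content_eq_0_subset)
qed

text \<open>
  The 0-dimensional measure counts nonempty sets, so it is the one exponent at which the content
  with its convention \<open>0 powr 0 = 0\<close> cannot replace the measure.
\<close>

lemma hausdorff_measure_0_eq_0D:
  fixes A :: "'a::metric_space set"
  assumes "hausdorff_measure 0 A = 0"
  shows "A = {}"
proof (rule ccontr)
  assume "A \<noteq> {}"
  have "1 \<le> hausdorff_premeasure 0 1 A"
    unfolding hausdorff_premeasure_def
  proof (rule INF_greatest)
    fix U :: "nat \<Rightarrow> 'a set"
    assume "U \<in> {U. A \<subseteq> (\<Union>n. U n) \<and> (\<forall>n. bounded (U n) \<and> diameter (U n) \<le> 1)}"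
    then obtain n where "U n \<noteq> {}" using \<open>A \<noteq> {}\<close> by fastforce
    then have "1 = hausdorff_weight 0 (U n)" by (simp add: hausdorff_weight_def)
    also have "\<dots> \<le> (\<Sum>n. hausdorff_weight 0 (U n))"
      using sum_le_suminf[OF summableI, of "{n}" "\<lambda>n. hausdorff_weight 0 (U n)"] by simp
    finally show "1 \<le> (\<Sum>n. hausdorff_weight 0 (U n))" .
  qed
  also have "\<dots> \<le> hausdorff_measure 0 A"
    unfolding hausdorff_measure_def by (rule SUP_upper) simp
  finally show False using assms by simp
qed

lemma hausdorff_dim_le:
  "0 \<le> s \<Longrightarrow> hausdorff_measure s A = 0 \<Longrightarrow> hausdorff_dim A \<le> ereal s"
  unfolding hausdorff_dim_def by (rule INF_lower) simp

theorem theorem2p6: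
  fixes F F' :: "real \<Rightarrow> real" and X :: "(real \<times> real) set set"
  assumes deriv: "\<And>x. x \<in> {0..1} \<Longrightarrow> (F has_real_derivative F' x) (at x within {0..1})"
    and lipschitz: "\<exists>L. L-lipschitz_on {0..1} F"
    and full_image: "\<And>A. A \<subseteq> {0..1} \<Longrightarrow>
           outer_measure_of lebesgue A = outer_measure_of lebesgue {0..1::real} \<Longrightarrow>
           hausdorff_dim (F' ` A) = 1"
    and lines: "\<And>l. l \<in> X \<Longrightarrow> is_line l"
    and cover: "(\<lambda>x. (x, F x)) ` {0..1} \<subseteq> \<Union>X"
  shows "hausdorff_dim (\<Union>X) = 2"
proof (rule antisym)
  show "hausdorff_dim (\<Union>X) \<le> 2"
  proof (rule ereal_le_epsilon2)
    fix e :: real assume "0 < e"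
    then have "hausdorff_content (2 + e) (\<Union>X) = 0"
      by (intro hausdorff_content_eq_0_subset[OF hausdorff_content_plane_eq_0]) auto
    then have "hausdorff_dim (\<Union>X) \<le> ereal (2 + e)"
      using \<open>0 < e\<close> by (intro hausdorff_dim_le) (auto simp: hausdorff_measure_eq_0_iff)
    then show "hausdorff_dim (\<Union>X) \<le> 2 + ereal e" by simp
  qed
next
  have False if r: "0 \<le> r" "hausdorff_measure r (\<Union>X) = 0" "r < 2" for r
  proof -
    \<comment> \<open>Exponents with \<open>r < u < 2\<close> and \<open>1 < u < 1 + s < 2\<close>.\<close>
    define u where "u = (max r 1 + 2) / 2"
    define s where "s = u / 2"
    have u: "1 < u" "r < u" "u - 1 < s" "s < 1" "0 < s" using \<open>r < 2\<close> by (auto simp: u_def s_def max_def)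
    have null: "hausdorff_content u (\<Union>X) = 0"
    proof (cases "r = 0")
      case True
      then have "\<Union>X = {}" using r(2) hausdorff_measure_0_eq_0D by blast
      moreover have "(0, F 0) \<in> (\<lambda>x. (x, F x)) ` {0..1}" by (rule imageI) simp
      ultimately show ?thesis using cover by blast
    next
      case False
      then have "0 < r" using r(1) by simp
      then have "hausdorff_content r (\<Union>X) = 0"
        using r(2) by (simp only: hausdorff_measure_eq_0_iff)
      then show ?thesis
        using \<open>0 < r\<close> less_imp_le[OF u(2)] by (rule hausdorff_content_eq_0_exponent)
    qed
    define E where "E = {e. \<forall>x\<in>{0..1}. line_point e x \<in> \<Union>X}"
    have E: "hausdorff_content s E = 0"
      unfolding E_def using null u(1,3,4) by (rule hausdorff_content_lines_eq_0)
    \<comment> \<open>Vertical lines become the horizontal lines with parameters \<open>(0, x)\<close> after interchanging the coordinates.\<close>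
    have "hausdorff_content u (prod.swap ` \<Union>X) = 0"
    proof (rule hausdorff_content_eq_0_relation[OF null, where R = "\<lambda>p q. p = prod.swap q" and L = 1])
      show "dist x y \<le> 1 * dist p q" if "x = prod.swap p" "y = prod.swap q" for x y p q :: "real \<times> real"
        using that by (simp add: dist_prod_def add.commute)
    qed (use u in auto)
    then have swapped: "hausdorff_content s {e. \<forall>x\<in>{0..1}. line_point e x \<in> prod.swap ` \<Union>X} = 0"
      using u(1,3,4) by (rule hausdorff_content_lines_eq_0)
    define V where "V = {x. \<forall>y. (x, y) \<in> \<Union>X}"
    have "hausdorff_content s V = 0"
    proof (rule hausdorff_content_eq_0_relation[OF swapped \<open>0 < s\<close>, where R = "\<lambda>x e. e = (0, x)" and L = 1])
      show "\<exists>e\<in>{e. \<forall>x\<in>{0..1}. line_point e x \<in> prod.swap ` \<Union>X}. e = (0, x)" if "x \<in> V" for x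
      proof -
        have "line_point (0, x) y \<in> prod.swap ` \<Union>X" for y
          using that unfolding V_def line_point_def by (intro image_eqI[of _ _ "(x, y)"]) auto
        then show ?thesis by blast
      qed
    qed (auto simp: dist_prod_def)
    then have V: "hausdorff_content 1 V = 0"
      using \<open>0 < s\<close> less_imp_le[OF \<open>s < 1\<close>] by (rule hausdorff_content_eq_0_exponent)
    have E1: "hausdorff_content 1 E = 0"
      using E \<open>0 < s\<close> less_imp_le[OF \<open>s < 1\<close>] by (rule hausdorff_content_eq_0_exponent)
    define A where "A = {x\<in>{0..1}. (F' x, F x - F' x * x) \<in> E}"
    define B where "B = {x\<in>{0..1}. \<exists>a. a \<noteq> F' x \<and> (a, F x - a * x) \<in> E}"
    have cover3: "{0..1} - A \<subseteq> V \<union> B"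
    proof
      fix x assume x: "x \<in> {0..1} - A"
      then obtain l where l: "l \<in> X" "(x, F x) \<in> l" using cover by blast
      from lines[OF l(1)] l(2) show "x \<in> V \<union> B"
      proof (cases rule: line_through_point)
        case (graph a)
        then have "(a, F x - a * x) \<in> E" using l by (auto simp: E_def)
        moreover have "a \<noteq> F' x" using x calculation by (auto simp: A_def)
        ultimately show ?thesis using x unfolding B_def by blast
      next
        case vertical
        then show ?thesis using l by (auto simp: V_def)
      qed
    qed
    have "negligible V"
      using V by (rule negligible_if_hausdorff_content_1)
    moreover have "negligible B"
      unfolding B_def using transversal_feet_null[OF E1 deriv] by (intro negligible_if_hausdorff_content_1)
    ultimately have "negligible ({0..1} - A)"
      using cover3 negligible_subset negligible_Un by blast
    then have N: "{0..1} - A \<in> null_sets lebesgue"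
      by (simp add: negligible_iff_null_sets)
    have "A = {0..1} - ({0..1} - A)" by (auto simp: A_def)
    moreover have "{0..1} - ({0..1} - A) \<in> sets lebesgue" using N by auto
    moreover have "emeasure lebesgue ({0..1} - ({0..1} - A)) = emeasure lebesgue {0..1::real}"
      using N by (intro emeasure_Diff_null_set) auto
    ultimately have "outer_measure_of lebesgue A = outer_measure_of lebesgue {0..1::real}"
      by simp
    then have "hausdorff_dim (F' ` A) = 1"
      by (intro full_image) (auto simp: A_def)
    moreover have "hausdorff_content s (F' ` A) = 0"
      using u E dist_fst_le
      by (intro hausdorff_content_eq_0_relation[OF E, where R = "\<lambda>a e. a = fst e" and L = 1])
        (force simp: A_def)+
    then have "hausdorff_dim (F' ` A) \<le> ereal s"
      using u by (intro hausdorff_dim_le) (auto simp: hausdorff_measure_eq_0_iff)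
    ultimately show False using u by simp
  qed
  then show "2 \<le> hausdorff_dim (\<Union>X)"
    unfolding hausdorff_dim_def by (intro INF_greatest) (force simp: not_less[symmetric])
qed

end
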